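(* Let $K$ be an infinite field and $n\ge 1$ an integer such that the characteristic of $K$ does not divide $n$. If a multilinear polynomial $p\in K\langle x_1,\dots,x_m\rangle$ is $\nu$-central on $M_n(K)$ with $\nu>1$, then $\nu=n$.
   Context: $K\langle x_1,\dots,x_m\rangle$ is the free associative algebra in noncommuting variables. A polynomial is multilinear if it is a $K$-linear combination of monomials $x_{\pi(1)}\cdots x_{\pi(m)}$ with $\pi\in S_m$. A polynomial is central on $M_n(K)$ if it takes on only scalar values on $M_n(K)$ but does not vanish identically. A polynomial $p$ is $\nu$-central if $p^\nu$ is central, with $\nu\ge 1$ minimal such. Characteristic $0$ is regarded as not dividing $n$. *)

theory Defs
  imports
    "HOL-Library.Poly_Mapping"
    "HOL-Combinatorics.Permutations"
    "Jordan_Normal_Form.Matrix"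
begin

text \<open>
  The free monoid on the letters \<open>0, 1, 2, \<dots>\<close>, written additively because the convolution product
  of \<^theory>\<open>HOL-Library.Poly_Mapping\<close> requires \<^class>\<open>monoid_add\<close> (which is not commutative).
\<close>

datatype free_mon = Mon (letters: "nat list")

instantiation free_mon :: monoid_add
begin

definition zero_free_mon :: free_mon where
  "0 = Mon []"

definition plus_free_mon :: "free_mon \<Rightarrow> free_mon \<Rightarrow> free_mon" where
  "u + v = Mon (letters u @ letters v)"

instance
  by standard (simp_all add: zero_free_mon_def plus_free_mon_def)

end

text \<open>
  The monoid algebra of the free monoid over \<open>K\<close>, i.e. the free associative algebra in the
  noncommuting variables \<open>x\<^sub>0, x\<^sub>1, x\<^sub>2, \<dots>\<close>, with the ring structure of
  \<^theory>\<open>HOL-Library.Poly_Mapping\<close>. The algebra \<open>K\<langle>x\<^sub>1, \<dots>, x\<^sub>m\<rangle>\<close> is the subalgebra of those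
  elements in which only \<open>x\<^sub>1, \<dots>, x\<^sub>m\<close> occur.
\<close>

type_synonym 'k free_alg = "free_mon \<Rightarrow>\<^sub>0 'k"

definition fvar :: "nat \<Rightarrow> 'k::ring_1 free_alg" where
  "fvar i = Poly_Mapping.single (Mon [i]) 1"

definition fconst :: "'k::ring_1 \<Rightarrow> 'k free_alg" where
  "fconst c = Poly_Mapping.single 0 c"

definition multilinear :: "nat \<Rightarrow> 'k::field free_alg \<Rightarrow> bool" where
  "multilinear m p \<longleftrightarrow>
     (\<exists>c :: (nat \<Rightarrow> nat) \<Rightarrow> 'k.
        p = (\<Sum>\<pi> | \<pi> permutes {1..m}. fconst (c \<pi>) * (\<Prod>i\<leftarrow>[1..<Suc m]. fvar (\<pi> i))))"

definition eval_mon :: "nat \<Rightarrow> (nat \<Rightarrow> 'k::field mat) \<Rightarrow> free_mon \<Rightarrow> 'k mat" where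
  "eval_mon n A w = foldr (\<lambda>i M. A i * M) (letters w) (1\<^sub>m n)"

text \<open>
  The value of \<open>f\<close> under \<open>x\<^sub>i \<mapsto> A i\<close> in \<open>n \<times> n\<close> matrices. The linear combination of
  matrices is formed entrywise, since \<^typ>\<open>'k mat\<close>, which contains matrices of all sizes, is not an
  additive monoid.
\<close>

definition eval_mat :: "nat \<Rightarrow> (nat \<Rightarrow> 'k::field mat) \<Rightarrow> 'k free_alg \<Rightarrow> 'k mat" where
  "eval_mat n A f =
     mat n n (\<lambda>(i, j). \<Sum>w\<in>Poly_Mapping.keys f. Poly_Mapping.lookup f w * eval_mon n A w $$ (i, j))"

text \<open>
  All variables \<open>x\<^sub>0, x\<^sub>1, \<dots>\<close> are assigned; the value depends only on those occurring in \<open>f\<close>.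
\<close>

definition central_on :: "nat \<Rightarrow> 'k::field free_alg \<Rightarrow> bool" where
  "central_on n f \<longleftrightarrow>
     (\<forall>A. (\<forall>i. A i \<in> carrier_mat n n) \<longrightarrow> (\<exists>c. eval_mat n A f = c \<cdot>\<^sub>m 1\<^sub>m n)) \<and>
     (\<exists>A. (\<forall>i. A i \<in> carrier_mat n n) \<and> eval_mat n A f \<noteq> 0\<^sub>m n n)"

definition nu_central_on :: "nat \<Rightarrow> nat \<Rightarrow> 'k::field free_alg \<Rightarrow> bool" where
  "nu_central_on \<nu> n p \<longleftrightarrow>
     1 \<le> \<nu> \<and> central_on n (p ^ \<nu>) \<and> (\<forall>k. 1 \<le> k \<and> k < \<nu> \<longrightarrow> \<not> central_on n (p ^ k))"

end

theory Submission
  imports Defs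
    "HOL-Computational_Algebra.Polynomial"
    "HOL-Number_Theory.Cong"
    "Jordan_Normal_Form.Column_Operations"
begin

text \<open>
  Let \<open>p\<close> be multilinear and \<open>p\<^sup>\<nu>\<close> central with \<open>\<nu> > 1\<close> minimal. Everything rests on one value of \<open>p\<close>
  that can be seen explicitly. Grade \<open>M\<^sub>n(K)\<close> by residues modulo \<open>n\<close>, giving the matrix unit at
  \<open>(i, j)\<close> the degree \<open>j - i\<close>. As \<open>p\<close> is multilinear, it sends homogeneous matrices to a homogeneous
  matrix, and every entry of an arbitrary value is a sum of entries of values at homogeneous
  matrices. Minimality of \<open>\<nu>\<close> says that \<open>p\<close> has a non-scalar value; conjugating it gives a value
  with a nonzero entry at \<open>(0, 1)\<close>, so there are homogeneous matrices at which \<open>p\<close> has that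
  property. The value then has degree 1, which means that it is supported on the positions
  \<open>(k, k + 1)\<close>. Shifting the indices moves the nonzero entry to any of these positions, and
  because \<open>K\<close> is infinite, a generic point on lines between such substitutions makes all \<open>n\<close>
  entries nonzero simultaneously. Such a matrix \<open>Q\<^sub>0\<close> is called cyclic here (lemma
  \<open>exists_cyclic_value\<close>). A power \<open>Q\<^sub>0\<^sup>t\<close> is scalar exactly if \<open>n\<close> divides \<open>t\<close>, so \<open>n\<close> divides \<open>\<nu>\<close>.

  Suppose \<open>\<nu> \<noteq> n\<close>, let \<open>l\<close> be a prime divisor of \<open>\<nu> / n\<close> and put \<open>k = \<nu> / l\<close>, still a multiple of \<open>n\<close>.
  By minimality \<open>p\<^sup>k\<close> has a non-scalar value, say at \<open>B\<close>. Join the substitution giving \<open>Q\<^sub>0\<close> to \<open>B\<close> by a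
  line with parameter \<open>s\<close>. Along it the values of \<open>p\<close> form a matrix \<open>Q\<close> over \<open>K[s]\<close>, and \<open>T = Q\<^sup>k\<close> has
  the properties that \<open>T\<^sup>l\<close> is scalar and that \<open>T(0) = Q\<^sub>0\<^sup>k\<close> is a nonzero scalar matrix. The
  contradiction is that \<open>T\<close> must be scalar (lemma \<open>scalar_of_prime_power_scalar\<close>). Otherwise write
  \<open>T = r + s\<^sup>e N\<close> with \<open>r\<close> an entry on the diagonal of \<open>T\<close> and \<open>N(0) \<noteq> 0\<close>; then \<open>N(0)\<close> is not scalar
  because it has a zero on the diagonal. If \<open>l\<close> is not the characteristic, then \<open>T\<^sup>l = r\<^sup>l + s\<^sup>e N U\<close>
  with \<open>U(0)\<close> a nonzero scalar matrix, so that \<open>N(0)\<close> is scalar after all. If \<open>l\<close> is the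
  characteristic, then \<open>T\<^sup>l = r\<^sup>l + s\<^bsup>el\<^esup> N\<^sup>l\<close>, so only \<open>N(0)\<^sup>l\<close> is known to be scalar. But \<open>T\<close> commutes
  with \<open>Q\<close>, hence \<open>N(0)\<close> with \<open>Q\<^sub>0\<close>, and a matrix commuting with \<open>Q\<^sub>0\<close> is a combination of
  \<open>1, Q\<^sub>0, \<dots>, Q\<^sub>0\<^bsup>n-1\<^esup>\<close>. Its \<open>l\<close>-th power is obtained by raising coefficients and powers of \<open>Q\<^sub>0\<close> to the
  \<open>l\<close>-th power. Since \<open>l\<close>, being the characteristic, does not divide \<open>n\<close>, multiplication by \<open>l\<close>
  permutes the residues modulo \<open>n\<close>, so nothing can cancel and all coefficients except the
  constant one vanish.
\<close>

section \<open>Square matrices and scalar matrices\<close>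

lemma smult_smult_mat: "a \<cdot>\<^sub>m (b \<cdot>\<^sub>m M) = (a * b :: 'a::semigroup_mult) \<cdot>\<^sub>m M"
  by (rule eq_matI) (auto simp: mult.assoc)

lemma mat_mult_index:
  assumes "A \<in> carrier_mat n n" "B \<in> carrier_mat n n" "i < n" "j < n"
  shows "(A * B) $$ (i, j) = (\<Sum>l<n. A $$ (i, l) * B $$ (l, j))"
  using assms by (auto simp: scalar_prod_def atLeast0LessThan)

definition scalar_matrix :: "nat \<Rightarrow> 'a::semiring_1 mat \<Rightarrow> bool" where
  "scalar_matrix n M \<longleftrightarrow> (\<exists>c. M = c \<cdot>\<^sub>m 1\<^sub>m n)"

text \<open>
  For matrices over \<open>K[s]\<close> this expresses scalarity by polynomial identities between entries, so
  that for infinite \<open>K\<close> it can be tested at the points of \<open>K\<close>.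
\<close>
lemma scalar_matrix_iff:
  fixes M :: "'a::semiring_1 mat"
  assumes "M \<in> carrier_mat n n"
  shows "scalar_matrix n M \<longleftrightarrow>
    (\<forall>i<n. \<forall>j<n. i \<noteq> j \<longrightarrow> M $$ (i, j) = 0) \<and> (\<forall>i<n. M $$ (i, i) = M $$ (0, 0))"
    (is "?L \<longleftrightarrow> ?R")
proof
  assume ?L
  then obtain c where "M = c \<cdot>\<^sub>m 1\<^sub>m n" by (auto simp: scalar_matrix_def)
  then show ?R by auto
next
  assume R: ?R
  have "M = M $$ (0, 0) \<cdot>\<^sub>m 1\<^sub>m n"
  proof (rule eq_matI)
    fix i j assume "i < dim_row (M $$ (0, 0) \<cdot>\<^sub>m 1\<^sub>m n)" "j < dim_col (M $$ (0, 0) \<cdot>\<^sub>m 1\<^sub>m n)"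
    then have ij: "i < n" "j < n" by auto
    then have "M $$ (i, j) = (if i = j then M $$ (0, 0) else 0)"
      using R by metis
    with ij show "M $$ (i, j) = (M $$ (0, 0) \<cdot>\<^sub>m 1\<^sub>m n) $$ (i, j)" by simp
  qed (use assms in auto)
  then show ?L unfolding scalar_matrix_def by blast
qed

lemma scalar_mult_mat:
  fixes M :: "'a::comm_semiring_1 mat"
  assumes "M \<in> carrier_mat n n"
  shows "(c \<cdot>\<^sub>m 1\<^sub>m n) * M = c \<cdot>\<^sub>m M" "M * (c \<cdot>\<^sub>m 1\<^sub>m n) = c \<cdot>\<^sub>m M"
  using assms by (simp_all add: mult_smult_assoc_mat[of _ n n _ n] mult_smult_distrib[of _ n n _ n])

lemma scalar_pow_mat:
  "(c \<cdot>\<^sub>m 1\<^sub>m n) ^\<^sub>m k = (c ^ k :: 'a::comm_semiring_1) \<cdot>\<^sub>m 1\<^sub>m n"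
proof (induction k)
  case 0
  then show ?case by (auto intro!: eq_matI)
next
  case (Suc k)
  then show ?case
    by (simp add: scalar_mult_mat(2)[of _ n]) (auto intro!: eq_matI simp: mult.commute)
qed

lemma pow_mat_add:
  fixes M :: "'a::semiring_1 mat"
  assumes "M \<in> carrier_mat n n"
  shows "M ^\<^sub>m (a + b) = M ^\<^sub>m a * M ^\<^sub>m b"
  using assms by (induction b) (simp_all add: assoc_mult_mat[of _ n n _ n _ n])

lemma pow_mat_mult:
  fixes M :: "'a::semiring_1 mat"
  assumes "M \<in> carrier_mat n n"
  shows "M ^\<^sub>m (a * b) = (M ^\<^sub>m a) ^\<^sub>m b"
  using assms by (induction b) (simp_all add: pow_mat_add[of _ n] add.commute[of a])

lemma pow_mat_commute:
  fixes M N :: "'a::semiring_1 mat"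
  assumes M: "M \<in> carrier_mat n n" and N: "N \<in> carrier_mat n n" and "M * N = N * M"
  shows "M ^\<^sub>m k * N = N * M ^\<^sub>m k"
proof (induction k)
  case (Suc k)
  have "M ^\<^sub>m Suc k * N = M ^\<^sub>m k * (N * M)"
    using M N assms(3) by (simp add: assoc_mult_mat[of _ n n _ n _ n])
  also have "\<dots> = M ^\<^sub>m k * N * M"
    using M N by (simp add: assoc_mult_mat[of _ n n _ n _ n])
  also have "\<dots> = N * M ^\<^sub>m k * M" by (simp add: Suc)
  finally show ?case
    using M N by (simp add: assoc_mult_mat[of _ n n _ n _ n])
qed (use M N in auto)

lemma smult_pow_mat:
  fixes M :: "'a::comm_semiring_1 mat"
  assumes "M \<in> carrier_mat n n"
  shows "(c \<cdot>\<^sub>m M) ^\<^sub>m k = c ^ k \<cdot>\<^sub>m M ^\<^sub>m k"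
proof (induction k)
  case 0
  then show ?case using assms by (auto intro!: eq_matI)
next
  case (Suc k)
  have "(c ^ k \<cdot>\<^sub>m M ^\<^sub>m k) * (c \<cdot>\<^sub>m M) = c \<cdot>\<^sub>m (c ^ k \<cdot>\<^sub>m (M ^\<^sub>m k * M))"
    using assms by (simp add: mult_smult_assoc_mat[of _ n n _ n] mult_smult_distrib[of _ n n _ n])
  also have "\<dots> = c ^ Suc k \<cdot>\<^sub>m (M ^\<^sub>m k * M)"
    by (auto intro!: eq_matI simp: mult.assoc)
  finally show ?case using Suc by simp
qed

section \<open>Polynomials in a matrix\<close>

text \<open>
  Substitution of a matrix for the variable. As a ring homomorphism from a commutative ring it
  transports identities that are unavailable in the noncommutative ring of matrices, in
  particular the additivity of the Frobenius map. It is written in Horner form so that the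
  homomorphism laws follow by induction on \<open>pCons\<close>.
\<close>
definition mat_poly :: "nat \<Rightarrow> 'a::comm_ring_1 mat \<Rightarrow> 'a poly \<Rightarrow> 'a mat" where
  "mat_poly n M f = fold_coeffs (\<lambda>c X. c \<cdot>\<^sub>m 1\<^sub>m n + M * X) f (0\<^sub>m n n)"

context
  fixes n :: nat and M :: "'a::comm_ring_1 mat"
  assumes M: "M \<in> carrier_mat n n"
begin

lemma mat_poly_0: "mat_poly n M 0 = 0\<^sub>m n n"
  by (simp add: mat_poly_def)

lemma mat_poly_pCons: "mat_poly n M (pCons c f) = c \<cdot>\<^sub>m 1\<^sub>m n + M * mat_poly n M f"
proof (cases "c = 0 \<and> f = 0")
  case True
  then show ?thesis using M by (auto simp: mat_poly_0 intro!: eq_matI)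
next
  case False
  then show ?thesis by (auto simp: mat_poly_def)
qed

lemma mat_poly_carrier [simp]: "mat_poly n M f \<in> carrier_mat n n"
  by (induction f) (use M in \<open>auto simp: mat_poly_0 mat_poly_pCons intro!: add_carrier_mat mult_carrier_mat\<close>)

lemma mat_poly_dim [simp]: "dim_row (mat_poly n M f) = n" "dim_col (mat_poly n M f) = n"
  using mat_poly_carrier[of f] by blast+

lemma mat_poly_add: "mat_poly n M (f + g) = mat_poly n M f + mat_poly n M g"
proof (induction f g rule: poly_induct2)
  case (pCons a f b g)
  have "(a + b) \<cdot>\<^sub>m 1\<^sub>m n + (M * mat_poly n M f + M * mat_poly n M g) =
        (a \<cdot>\<^sub>m 1\<^sub>m n + M * mat_poly n M f) + (b \<cdot>\<^sub>m 1\<^sub>m n + M * mat_poly n M g)"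
    using M mat_poly_carrier[of f] mat_poly_carrier[of g]
    by (intro eq_matI) (auto simp: ring_distribs)
  then show ?case
    using M pCons by (simp add: mat_poly_pCons mult_add_distrib_mat[of _ n n _ n])
qed (simp add: mat_poly_0)

lemma mat_poly_smult: "mat_poly n M (smult c f) = c \<cdot>\<^sub>m mat_poly n M f"
proof (induction f)
  case (pCons a f)
  have "(c * a) \<cdot>\<^sub>m 1\<^sub>m n + c \<cdot>\<^sub>m (M * mat_poly n M f) =
        c \<cdot>\<^sub>m (a \<cdot>\<^sub>m 1\<^sub>m n + M * mat_poly n M f)"
    using M mat_poly_carrier[of f] by (intro eq_matI) (auto simp: ring_distribs)
  then show ?case
    using M pCons by (simp add: mat_poly_pCons mult_smult_distrib[of _ n n _ n])
qed (simp add: mat_poly_0)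

lemma mat_poly_mult: "mat_poly n M (f * g) = mat_poly n M f * mat_poly n M g"
proof (induction f)
  case (pCons a f)
  have "mat_poly n M (pCons a f * g) = a \<cdot>\<^sub>m mat_poly n M g + M * (mat_poly n M f * mat_poly n M g)"
    using M pCons by (auto simp: mat_poly_add mat_poly_smult mat_poly_pCons intro!: eq_matI)
  also have "\<dots> = mat_poly n M (pCons a f) * mat_poly n M g"
    using M by (simp add: mat_poly_pCons add_mult_distrib_mat[of _ n n _ _ n] scalar_mult_mat[of _ n]
        assoc_mult_mat[of _ n n _ n _ n] mult_carrier_mat[of _ n n _ n])
  finally show ?case .
qed (simp add: mat_poly_0 left_mult_zero_mat[of _ n n])

lemma mat_poly_const: "mat_poly n M [:c:] = c \<cdot>\<^sub>m 1\<^sub>m n"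
  using M by (auto simp: mat_poly_pCons mat_poly_0 intro!: eq_matI)

lemma mat_poly_power: "mat_poly n M (f ^ k) = mat_poly n M f ^\<^sub>m k"
proof (induction k)
  case 0
  have "mat_poly n M [:1:] = 1\<^sub>m n" by (simp only: mat_poly_const) (auto intro!: eq_matI)
  then show ?case by (simp add: one_pCons)
next
  case (Suc k)
  then show ?case by (simp add: power_Suc2 mat_poly_mult del: power_Suc)
qed

lemma mat_poly_X: "mat_poly n M [:0, 1:] = M"
  using M by (auto simp: mat_poly_pCons mat_poly_0 intro!: eq_matI)

lemma mat_poly_monom: "mat_poly n M (monom c k) = c \<cdot>\<^sub>m M ^\<^sub>m k"
proof -
  have "monom c k = smult c ([:0, 1:] ^ k)" by (rule monom_altdef)
  then show ?thesis by (simp only: mat_poly_smult mat_poly_power mat_poly_X)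
qed

lemma mat_poly_sum_index:
  assumes "i < n" "j < n"
  shows "mat_poly n M (\<Sum>x\<in>S. f x) $$ (i, j) = (\<Sum>x\<in>S. mat_poly n M (f x) $$ (i, j))"
  by (induction S rule: infinite_finite_induct)
    (use assms mat_poly_carrier in \<open>simp_all add: mat_poly_0 mat_poly_add\<close>)

end

text \<open>
  The identity \<open>(x - r)\<^sup>q = x\<^sup>q - r\<^sup>q\<close> holds for polynomials in \<open>x\<close>; substitute \<open>M\<close> for \<open>x\<close>.
\<close>
lemma freshmans_dream_mat:
  fixes M :: "'a::comm_ring_1 mat"
  assumes M: "M \<in> carrier_mat n n" and q: "prime CHAR('a)" "q = CHAR('a)"
  shows "(M - r \<cdot>\<^sub>m 1\<^sub>m n) ^\<^sub>m q = M ^\<^sub>m q - r ^ q \<cdot>\<^sub>m 1\<^sub>m n"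
proof -
  have "([:-r, 1:] + [:r:]) ^ q = [:-r, 1:] ^ q + [:r:] ^ q"
    using q by (intro freshmans_dream) auto
  then have "mat_poly n M [:0, 1:] ^\<^sub>m q = mat_poly n M [:-r, 1:] ^\<^sub>m q + mat_poly n M [:r:] ^\<^sub>m q"
    using M by (simp flip: mat_poly_power mat_poly_add)
  moreover have "mat_poly n M [:-r, 1:] = M - r \<cdot>\<^sub>m 1\<^sub>m n"
    using M by (auto simp: mat_poly_pCons[OF M] mat_poly_0 intro!: eq_matI)
  ultimately have "M ^\<^sub>m q = (M - r \<cdot>\<^sub>m 1\<^sub>m n) ^\<^sub>m q + r ^ q \<cdot>\<^sub>m 1\<^sub>m n"
    using M by (simp add: mat_poly_X mat_poly_const scalar_pow_mat)
  moreover have "X = Y - Z" if "Y = X + Z" "X \<in> carrier_mat n n" "Y \<in> carrier_mat n n" "Z \<in> carrier_mat n n" for X Y Z :: "'a mat"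
    using that by (auto intro!: eq_matI)
  ultimately show ?thesis
    using M by (simp add: minus_carrier_mat)
qed

section \<open>Cyclic matrices and what commutes with them\<close>

text \<open>
  The support is that of the permutation matrix of the full cycle; the nonzero entries are
  arbitrary. The \<open>n\<close>-th power of such a matrix is the product of these entries times the
  identity.
\<close>
definition cyclic_matrix :: "nat \<Rightarrow> 'a::zero mat \<Rightarrow> bool" where
  "cyclic_matrix n Q \<longleftrightarrow> Q \<in> carrier_mat n n \<and>
     (\<forall>i<n. \<forall>j<n. Q $$ (i, j) \<noteq> 0 \<longleftrightarrow> j = (i + 1) mod n)"

lemma cyclic_matrix_carrier: "cyclic_matrix n Q \<Longrightarrow> Q \<in> carrier_mat n n"
  by (simp add: cyclic_matrix_def)

text \<open>
  In row \<open>i\<close> of \<open>Q\<^sup>t\<close> only the walk \<open>i, i + 1, \<dots>, i + t\<close> along the cycle contributes, so that entry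
  is a product of \<open>t\<close> nonzero entries of \<open>Q\<close>.
\<close>
lemma cyclic_matrix_pow:
  fixes Q :: "'a::field mat"
  assumes Q: "cyclic_matrix n Q" and ij: "i < n" "j < n"
  shows "(Q ^\<^sub>m t) $$ (i, j) \<noteq> 0 \<longleftrightarrow> j = (i + t) mod n"
  using ij(2)
proof (induction t arbitrary: j)
  case 0
  then show ?case using ij(1) cyclic_matrix_carrier[OF Q] by auto
next
  case (Suc t)
  let ?l = "(i + t) mod n"
  have C: "Q \<in> carrier_mat n n" using Q by (rule cyclic_matrix_carrier)
  have l: "?l < n" using ij by simp
  have "(Q ^\<^sub>m Suc t) $$ (i, j) = (\<Sum>l<n. (Q ^\<^sub>m t) $$ (i, l) * Q $$ (l, j))"
    using C ij Suc.prems by (simp add: mat_mult_index[of _ n] del: index_mult_mat)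
  also have "\<dots> = (\<Sum>l\<in>{?l}. (Q ^\<^sub>m t) $$ (i, l) * Q $$ (l, j))"
    by (rule sum.mono_neutral_right) (use l Suc.IH in auto)
  finally have "(Q ^\<^sub>m Suc t) $$ (i, j) = (Q ^\<^sub>m t) $$ (i, ?l) * Q $$ (?l, j)" by simp
  moreover have "(Q ^\<^sub>m t) $$ (i, ?l) \<noteq> 0" using Suc.IH[OF l] by simp
  moreover have "Q $$ (?l, j) \<noteq> 0 \<longleftrightarrow> j = (?l + 1) mod n"
    using Q l Suc.prems by (simp add: cyclic_matrix_def)
  ultimately show ?case by (simp add: mod_Suc_eq)
qed

text \<open>
  If \<open>n\<close> divides \<open>t\<close>, then \<open>Q\<^sup>t\<close> is diagonal, and commuting with \<open>Q\<close> forces neighbouring diagonal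
  entries to agree. Otherwise \<open>Q\<^sup>t\<close> has a nonzero entry off the diagonal in row \<open>0\<close>.
\<close>
lemma cyclic_matrix_pow_scalar_iff:
  fixes Q :: "'a::field mat"
  assumes Q: "cyclic_matrix n Q" and n: "0 < n"
  shows "scalar_matrix n (Q ^\<^sub>m t) \<longleftrightarrow> n dvd t"
proof -
  have C: "Q \<in> carrier_mat n n" using Q by (rule cyclic_matrix_carrier)
  show ?thesis
  proof
    assume "scalar_matrix n (Q ^\<^sub>m t)"
    then have off: "\<forall>i<n. \<forall>j<n. i \<noteq> j \<longrightarrow> (Q ^\<^sub>m t) $$ (i, j) = 0"
      using scalar_matrix_iff[OF pow_carrier_mat[OF C]] by blast
    have "(Q ^\<^sub>m t) $$ (0, t mod n) \<noteq> 0"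
      using cyclic_matrix_pow[OF Q n, of "t mod n" t] n by simp
    then have "t mod n = 0" using off n by (metis mod_less_divisor)
    then show "n dvd t" by auto
  next
    assume t: "n dvd t"
    let ?T = "Q ^\<^sub>m t"
    have T: "?T \<in> carrier_mat n n" using C by simp
    have off: "?T $$ (i, j) = 0" if "i < n" "j < n" "i \<noteq> j" for i j
    proof -
      obtain u where "t = n * u" using t by blast
      then show ?thesis using cyclic_matrix_pow[OF Q that(1,2), of t] that by simp
    qed
    have comm: "?T * Q = Q * ?T" by (rule pow_mat_commute[OF C C refl])
    have diag: "?T $$ (i, i) = ?T $$ (0, 0)" if "i < n" for i
      using that
    proof (induction i)
      case (Suc i)
      have i: "i < n" using Suc.prems by simp
      have "(?T * Q) $$ (i, Suc i) = (\<Sum>l\<in>{i}. ?T $$ (i, l) * Q $$ (l, Suc i))"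
        unfolding mat_mult_index[OF T C i Suc.prems]
        by (rule sum.mono_neutral_right) (use off i in auto)
      moreover have "(Q * ?T) $$ (i, Suc i) = (\<Sum>l\<in>{Suc i}. Q $$ (i, l) * ?T $$ (l, Suc i))"
        unfolding mat_mult_index[OF C T i Suc.prems]
        by (rule sum.mono_neutral_right) (use off Suc.prems in auto)
      ultimately have "?T $$ (i, i) * Q $$ (i, Suc i) = Q $$ (i, Suc i) * ?T $$ (Suc i, Suc i)"
        by (auto simp: comm)
      moreover have "Q $$ (i, Suc i) \<noteq> 0"
        using Q i Suc.prems by (simp add: cyclic_matrix_def)
      ultimately show ?case using Suc.IH i by simp
    qed simp
    show "scalar_matrix n ?T"
      unfolding scalar_matrix_iff[OF T] using off diag by blast
  qed
qed

text \<open>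
  Row \<open>0\<close> of \<open>Q\<^sup>i\<close> is a multiple of the \<open>i\<close>-th unit vector, so row \<open>0\<close> of \<open>Q\<^sup>i N\<close> is a multiple of row \<open>i\<close>
  of \<open>N\<close>. Computing it as row \<open>0\<close> of \<open>N Q\<^sup>i\<close> shows that a matrix commuting with \<open>Q\<close> is determined by
  its row \<open>0\<close>.
\<close>
lemma cyclic_commutant_row:
  fixes Q N :: "'a::field mat"
  assumes Q: "cyclic_matrix n Q" and N: "N \<in> carrier_mat n n" and "Q * N = N * Q"
    and ij: "i < n" "j < n"
  shows "N $$ (i, j) = (\<Sum>l<n. N $$ (0, l) * (Q ^\<^sub>m i) $$ (l, j)) / (Q ^\<^sub>m i) $$ (0, i)"
proof -
  have C: "Q \<in> carrier_mat n n" using Q by (rule cyclic_matrix_carrier)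
  have n: "0 < n" using ij by simp
  note piv = cyclic_matrix_pow[OF Q n, of _ i]
  have "(\<Sum>l<n. N $$ (0, l) * (Q ^\<^sub>m i) $$ (l, j)) = (N * Q ^\<^sub>m i) $$ (0, j)"
    using C N n ij by (simp add: mat_mult_index[of _ n] del: index_mult_mat)
  also have "N * Q ^\<^sub>m i = Q ^\<^sub>m i * N"
    using pow_mat_commute[OF C N assms(3)] by simp
  also have "(Q ^\<^sub>m i * N) $$ (0, j) = (\<Sum>l<n. (Q ^\<^sub>m i) $$ (0, l) * N $$ (l, j))"
    using C N n ij by (simp add: mat_mult_index[of _ n] del: index_mult_mat)
  also have "\<dots> = (\<Sum>l\<in>{i}. (Q ^\<^sub>m i) $$ (0, l) * N $$ (l, j))"
    by (rule sum.mono_neutral_right) (use ij piv in auto)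
  finally show ?thesis using piv[of i] ij by (simp add: field_simps)
qed

text \<open>
  The rows \<open>0\<close> of \<open>1, Q, \<dots>, Q\<^bsup>n-1\<^esup>\<close> are nonzero multiples of the unit vectors, so some combination
  of these powers has the same row \<open>0\<close> as \<open>N\<close>, and both matrices commute with \<open>Q\<close>.
\<close>
lemma cyclic_commutant:
  fixes Q N :: "'a::field mat"
  assumes Q: "cyclic_matrix n Q" and N: "N \<in> carrier_mat n n" and comm: "Q * N = N * Q"
  obtains g where "N = mat_poly n Q (\<Sum>t<n. monom (g t) t)"
proof
  \<comment> \<open>chosen such that \<open>?F\<close> has the same row \<open>0\<close> as \<open>N\<close>\<close>
  let ?g = "\<lambda>t. N $$ (0, t) / (Q ^\<^sub>m t) $$ (0, t)"
  let ?f = "\<Sum>t<n. monom (?g t) t"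
  let ?F = "mat_poly n Q ?f"
  have C: "Q \<in> carrier_mat n n" using Q by (rule cyclic_matrix_carrier)
  have F: "?F \<in> carrier_mat n n" using C by simp
  have commF: "Q * ?F = ?F * Q"
    using mat_poly_mult[OF C, of ?f "[:0, 1:]"] mat_poly_mult[OF C, of "[:0, 1:]" ?f]
    by (simp only: mat_poly_X[OF C] mult.commute)
  have row: "?F $$ (0, j) = N $$ (0, j)" if j: "j < n" for j
  proof -
    have n: "0 < n" using j by simp
    have "?F $$ (0, j) = (\<Sum>t<n. ?g t * (Q ^\<^sub>m t) $$ (0, j))"
      using C n j by (simp add: mat_poly_sum_index mat_poly_monom)
    also have "\<dots> = (\<Sum>t\<in>{j}. ?g t * (Q ^\<^sub>m t) $$ (0, j))"
    proof (rule sum.mono_neutral_right)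
      have "(Q ^\<^sub>m t) $$ (0, j) = 0" if "t < n" "t \<noteq> j" for t
        using cyclic_matrix_pow[OF Q n j, of t] that by auto
      then show "\<forall>t\<in>{..<n} - {j}. ?g t * (Q ^\<^sub>m t) $$ (0, j) = 0" by simp
    qed (use j in auto)
    finally show ?thesis using cyclic_matrix_pow[OF Q n j] j by simp
  qed
  show "N = ?F"
  proof (rule eq_matI)
    fix i j assume "i < dim_row ?F" "j < dim_col ?F"
    then have ij: "i < n" "j < n" using F by auto
    then show "N $$ (i, j) = ?F $$ (i, j)"
      unfolding cyclic_commutant_row[OF Q N comm ij] cyclic_commutant_row[OF Q F commF ij]
      by (simp add: row)
  qed (use N F in auto)
qed

text \<open>
  Write \<open>N = \<Sum> g\<^sub>t Q\<^sup>t\<close> with \<open>t < n\<close>. In characteristic \<open>q\<close> this gives \<open>N\<^sup>q = \<Sum> g\<^sub>t\<^sup>q Q\<^bsup>tq\<^esup>\<close>. As \<open>q\<close> is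
  invertible modulo \<open>n\<close>, the summands have pairwise disjoint supports, and only the one with
  \<open>t = 0\<close> meets the diagonal.
\<close>
lemma cyclic_commutant_power_scalar:
  fixes Q N :: "'a::field mat"
  assumes Q: "cyclic_matrix n Q" and N: "N \<in> carrier_mat n n" and comm: "Q * N = N * Q"
    and q: "prime q" "q = CHAR('a)" "\<not> q dvd n" and scal: "scalar_matrix n (N ^\<^sub>m q)" and n: "0 < n"
  shows "scalar_matrix n N"
proof -
  have C: "Q \<in> carrier_mat n n" using Q by (rule cyclic_matrix_carrier)
  obtain g where g: "N = mat_poly n Q (\<Sum>t<n. monom (g t) t)"
    using cyclic_commutant[OF Q N comm] .
  have "(\<Sum>t<n. monom (g t) t) ^ q = (\<Sum>t<n. monom (g t) t ^ q)"
    using q by (intro freshmans_dream_sum) auto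
  then have Nq: "N ^\<^sub>m q = mat_poly n Q (\<Sum>t<n. monom (g t ^ q) (t * q))"
    by (simp add: g mat_poly_power[OF C, symmetric] monom_power)
  have cop: "coprime q n" using q by (simp add: prime_imp_coprime)
  have inj: "t = u" if "t < n" "u < n" "t * q mod n = u * q mod n" for t u
  proof -
    have "[t * q = u * q] (mod n)" using that(3) by (simp add: cong_def)
    then have "[t = u] (mod n)" using cop by (simp add: cong_mult_rcancel_nat)
    then show ?thesis using that by (simp add: cong_def)
  qed
  have "g t = 0" if t: "t < n" "t \<noteq> 0" for t
  proof -
    let ?j = "t * q mod n"
    have j: "?j < n" "?j \<noteq> 0" using n t inj[of t 0] by auto
    have "(N ^\<^sub>m q) $$ (0, ?j) = (\<Sum>u<n. g u ^ q * (Q ^\<^sub>m (u * q)) $$ (0, ?j))"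
      unfolding Nq using C n j by (simp add: mat_poly_sum_index mat_poly_monom)
    also have "\<dots> = (\<Sum>u\<in>{t}. g u ^ q * (Q ^\<^sub>m (u * q)) $$ (0, ?j))"
    proof (rule sum.mono_neutral_right)
      show "\<forall>u\<in>{..<n} - {t}. g u ^ q * (Q ^\<^sub>m (u * q)) $$ (0, ?j) = 0"
      proof
        fix u assume u: "u \<in> {..<n} - {t}"
        then have "?j \<noteq> (0 + u * q) mod n" using inj[of t u] t by auto
        then have "(Q ^\<^sub>m (u * q)) $$ (0, ?j) = 0"
          using cyclic_matrix_pow[OF Q n j(1), of "u * q"] by simp
        then show "g u ^ q * (Q ^\<^sub>m (u * q)) $$ (0, ?j) = 0" by simp
      qed
    qed (use t in auto)
    finally have "(N ^\<^sub>m q) $$ (0, ?j) = g t ^ q * (Q ^\<^sub>m (t * q)) $$ (0, ?j)" by simp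
    moreover have "(N ^\<^sub>m q) $$ (0, ?j) = 0"
      using scal scalar_matrix_iff[of "N ^\<^sub>m q" n] N n j by (metis pow_carrier_mat)
    moreover have "(Q ^\<^sub>m (t * q)) $$ (0, ?j) \<noteq> 0"
      using cyclic_matrix_pow[OF Q n j(1), of "t * q"] by simp
    ultimately show "g t = 0" by simp
  qed
  then have "(\<Sum>t<n. monom (g t) t) = (\<Sum>t\<in>{0}. monom (g t) t)"
    by (intro sum.mono_neutral_right) (use n in auto)
  then have "N = mat_poly n Q [:g 0:]"
    unfolding g by (simp add: monom_0)
  then show ?thesis
    unfolding scalar_matrix_def mat_poly_const[OF C] by blast
qed

section \<open>Matrices over a polynomial ring\<close>

interpretation poly_at: semiring_hom "\<lambda>f::'a::comm_ring_1 poly. poly f a" for a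
  by unfold_locales auto

abbreviation mat_at :: "'a::comm_ring_1 \<Rightarrow> 'a poly mat \<Rightarrow> 'a mat" where
  "mat_at a \<equiv> map_mat (\<lambda>f. poly f a)"

lemma mat_at_scalar: "mat_at a (c \<cdot>\<^sub>m 1\<^sub>m n) = poly c a \<cdot>\<^sub>m 1\<^sub>m n"
  by (auto intro!: eq_matI)

lemma mat_at_add:
  assumes "A \<in> carrier_mat n n" "B \<in> carrier_mat n n"
  shows "mat_at a (A + B) = mat_at a A + mat_at a B"
  using assms by (auto intro!: eq_matI)

lemma scalar_matrix_mat_at: "scalar_matrix n M \<Longrightarrow> scalar_matrix n (mat_at a M)"
  by (auto simp: scalar_matrix_def mat_at_scalar)

lemma scalar_matrix_diff:
  assumes "scalar_matrix n (M :: 'a::ring_1 mat)"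
  shows "scalar_matrix n (M - c \<cdot>\<^sub>m 1\<^sub>m n)"
proof -
  obtain d where "M = d \<cdot>\<^sub>m 1\<^sub>m n" using assms by (auto simp: scalar_matrix_def)
  then have "M - c \<cdot>\<^sub>m 1\<^sub>m n = (d - c) \<cdot>\<^sub>m 1\<^sub>m n" by (auto intro!: eq_matI simp: ring_distribs)
  then show ?thesis unfolding scalar_matrix_def by blast
qed

lemma scalar_matrix_smult_iff:
  fixes M :: "'a::idom mat"
  assumes "M \<in> carrier_mat n n" "c \<noteq> 0"
  shows "scalar_matrix n (c \<cdot>\<^sub>m M) \<longleftrightarrow> scalar_matrix n M"
proof -
  have cM: "c \<cdot>\<^sub>m M \<in> carrier_mat n n" using assms(1) by simp
  have "(c \<cdot>\<^sub>m M) $$ (i, j) = 0 \<longleftrightarrow> M $$ (i, j) = 0" if "i < n" "j < n" for i j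
    using assms that by simp
  moreover have "(c \<cdot>\<^sub>m M) $$ (i, i) = (c \<cdot>\<^sub>m M) $$ (0, 0) \<longleftrightarrow> M $$ (i, i) = M $$ (0, 0)"
    if "i < n" for i
  proof -
    have "0 < n" using that by simp
    with assms that show ?thesis by simp
  qed
  ultimately show ?thesis
    unfolding scalar_matrix_iff[OF cM] scalar_matrix_iff[OF assms(1)] by blast
qed

lemma exists_poly_nonroot:
  assumes "infinite (UNIV :: 'k::field set)" and "(f :: 'k poly) \<noteq> 0"
  obtains s where "poly f s \<noteq> 0"
  using poly_roots_finite[OF assms(2)] assms(1) ex_new_if_finite by blast

lemma poly_eq_0_if_all_roots:
  assumes "infinite (UNIV :: 'k::field set)" and "\<And>s. poly (f :: 'k poly) s = 0"
  shows "f = 0"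
  using assms exists_poly_nonroot by blast

lemma scalar_matrix_if_all_mat_at:
  fixes M :: "'k::field poly mat"
  assumes inf: "infinite (UNIV :: 'k set)" and M: "M \<in> carrier_mat n n"
    and scal: "\<And>s. scalar_matrix n (mat_at s M)"
  shows "scalar_matrix n M"
proof -
  have Ms: "mat_at s M \<in> carrier_mat n n" for s using M by simp
  have ev: "poly (M $$ (i, j)) s = mat_at s M $$ (i, j)" if "i < n" "j < n" for i j s
    using carrier_matD[OF M] that by simp
  have "M $$ (i, j) = 0" if "i < n" "j < n" "i \<noteq> j" for i j
  proof (rule poly_eq_0_if_all_roots[OF inf])
    show "poly (M $$ (i, j)) s = 0" for s
      unfolding ev[OF that(1,2)] using scal[of s] that unfolding scalar_matrix_iff[OF Ms] by blast
  qed
  moreover have "M $$ (i, i) = M $$ (0, 0)" if i: "i < n" for i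
  proof -
    have n: "0 < n" using i by simp
    have "mat_at s M $$ (i, i) = mat_at s M $$ (0, 0)" for s
      using scal[of s] i unfolding scalar_matrix_iff[OF Ms] by blast
    then have "poly (M $$ (i, i) - M $$ (0, 0)) s = 0" for s
      by (simp only: poly_diff ev[OF i i] ev[OF n n] diff_self)
    then have "M $$ (i, i) - M $$ (0, 0) = 0" by (rule poly_eq_0_if_all_roots[OF inf])
    then show ?thesis by simp
  qed
  ultimately show ?thesis unfolding scalar_matrix_iff[OF M] by blast
qed

text \<open>
  Divide by the highest power of the variable that divides all entries.
\<close>
lemma poly_mat_lowest_order:
  fixes M :: "'a::field poly mat"
  assumes M: "M \<in> carrier_mat n n" "M \<noteq> 0\<^sub>m n n"
  obtains k N where "N \<in> carrier_mat n n" "M = [:0, 1:] ^ k \<cdot>\<^sub>m N" "mat_at 0 N \<noteq> 0\<^sub>m n n"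
proof -
  define D where "D k \<longleftrightarrow> (\<forall>i<n. \<forall>j<n. [:0, 1:] ^ k dvd M $$ (i, j))" for k
  obtain i j where ij: "i < n" "j < n" "M $$ (i, j) \<noteq> 0"
    using M by (metis carrier_matD eq_matI index_zero_mat)
  have "\<not> D (Suc (degree (M $$ (i, j))))"
  proof
    assume "D (Suc (degree (M $$ (i, j))))"
    then have "degree ([:0, 1:] ^ Suc (degree (M $$ (i, j))) :: 'a poly) \<le> degree (M $$ (i, j))"
      using ij by (intro dvd_imp_degree_le) (auto simp: D_def)
    then show False by (simp add: degree_power_eq)
  qed
  moreover have "D 0" by (simp add: D_def)
  ultimately obtain k where k: "D k" "\<not> D (Suc k)"
    using nat_induct[of D] by blast
  define N where "N = mat n n (\<lambda>(i, j). M $$ (i, j) div [:0, 1:] ^ k)"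
  have MN: "M = [:0, 1:] ^ k \<cdot>\<^sub>m N"
    using M k(1) by (auto intro!: eq_matI simp: N_def D_def)
  have "mat_at 0 N \<noteq> 0\<^sub>m n n"
  proof
    assume N0: "mat_at 0 N = 0\<^sub>m n n"
    have "D (Suc k)" unfolding D_def
    proof (intro allI impI)
      fix i j assume ij: "i < n" "j < n"
      have "poly (N $$ (i, j)) 0 = mat_at 0 N $$ (i, j)" using ij by (simp add: N_def)
      then have "[:0, 1:] dvd N $$ (i, j)"
        using N0 ij poly_eq_0_iff_dvd[of "N $$ (i, j)" 0] by simp
      then have "[:0, 1:] ^ k * [:0, 1:] dvd [:0, 1:] ^ k * N $$ (i, j)" by (rule mult_dvd_mono[OF dvd_refl])
      then show "[:0, 1:] ^ Suc k dvd M $$ (i, j)"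
        using ij unfolding MN by (simp add: N_def mult.commute)
    qed
    with k show False by simp
  qed
  moreover have "N \<in> carrier_mat n n" by (simp add: N_def)
  ultimately show ?thesis using that[of N k] MN by blast
qed

text \<open>
  This is the factorisation \<open>T\<^sup>k - r\<^sup>k = (T - r) U\<close> with \<open>U = \<Sum> r\<^bsup>k-1-i\<^esup> T\<^sup>i\<close>, whose value at \<open>0\<close> is
  \<open>k \<tau>\<^bsup>k-1\<^esup>\<close>. The factor \<open>\<tau>\<close> in the last equation avoids the exponent \<open>k - 1\<close>.
\<close>
lemma pow_mat_around_scalar:
  fixes T :: "'a::comm_ring_1 poly mat"
  assumes T: "T \<in> carrier_mat n n" and T0: "mat_at 0 T = \<tau> \<cdot>\<^sub>m 1\<^sub>m n" and r0: "poly r 0 = \<tau>"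
  shows "\<exists>U. U \<in> carrier_mat n n \<and> T ^\<^sub>m k = r ^ k \<cdot>\<^sub>m 1\<^sub>m n + (T - r \<cdot>\<^sub>m 1\<^sub>m n) * U \<and>
    \<tau> \<cdot>\<^sub>m mat_at 0 U = (of_nat k * \<tau> ^ k) \<cdot>\<^sub>m 1\<^sub>m n"
proof (induction k)
  case 0
  have "T ^\<^sub>m 0 = r ^ 0 \<cdot>\<^sub>m 1\<^sub>m n + (T - r \<cdot>\<^sub>m 1\<^sub>m n) * 0\<^sub>m n n"
    using T by (auto intro!: eq_matI simp: minus_carrier_mat)
  moreover have "\<tau> \<cdot>\<^sub>m mat_at 0 (0\<^sub>m n n) = (of_nat 0 * \<tau> ^ 0) \<cdot>\<^sub>m 1\<^sub>m n"
    by (auto intro!: eq_matI)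
  ultimately show ?case by (intro exI[of _ "0\<^sub>m n n"]) simp
next
  case (Suc k)
  let ?M = "T - r \<cdot>\<^sub>m 1\<^sub>m n"
  obtain U where U: "U \<in> carrier_mat n n" "T ^\<^sub>m k = r ^ k \<cdot>\<^sub>m 1\<^sub>m n + ?M * U"
    "\<tau> \<cdot>\<^sub>m mat_at 0 U = (of_nat k * \<tau> ^ k) \<cdot>\<^sub>m 1\<^sub>m n"
    using Suc.IH by blast
  let ?V = "r ^ k \<cdot>\<^sub>m 1\<^sub>m n + U * T"
  have M: "?M \<in> carrier_mat n n" using T by (simp add: minus_carrier_mat)
  have V: "?V \<in> carrier_mat n n" using U T by (simp add: mult_carrier_mat[of _ n n _ n])
  have UT: "U * T \<in> carrier_mat n n" "?M * (U * T) \<in> carrier_mat n n"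
    using U T M by (simp_all add: mult_carrier_mat[of _ n n _ n])
  have "T ^\<^sub>m Suc k = r ^ k \<cdot>\<^sub>m T + ?M * (U * T)"
    using U T M by (simp add: add_mult_distrib_mat[of _ n n _ _ n] scalar_mult_mat[of _ n]
        assoc_mult_mat[of _ n n _ n _ n] mult_carrier_mat[of _ n n _ n])
  also have "\<dots> = r ^ Suc k \<cdot>\<^sub>m 1\<^sub>m n + (r ^ k \<cdot>\<^sub>m ?M + ?M * (U * T))"
    using T UT(2) by (intro eq_matI) (auto simp: ring_distribs mult.commute[of r] simp del: index_mult_mat(1))
  also have "r ^ k \<cdot>\<^sub>m ?M + ?M * (U * T) = ?M * ?V"
    using M UT by (simp add: mult_add_distrib_mat[of _ n n _ n] scalar_mult_mat[of _ n])
  finally have 1: "T ^\<^sub>m Suc k = r ^ Suc k \<cdot>\<^sub>m 1\<^sub>m n + ?M * ?V" .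
  have "mat_at 0 ?V = \<tau> ^ k \<cdot>\<^sub>m 1\<^sub>m n + mat_at 0 U * mat_at 0 T"
    using mat_at_add[OF _ UT(1), of "r ^ k \<cdot>\<^sub>m 1\<^sub>m n" 0] poly_at.mat_hom_mult[OF U(1) T, of 0] r0
    by (simp add: mat_at_scalar)
  also have "mat_at 0 U * mat_at 0 T = \<tau> \<cdot>\<^sub>m mat_at 0 U"
    unfolding T0 using U by (simp add: scalar_mult_mat[of _ n])
  also have "\<dots> = (of_nat k * \<tau> ^ k) \<cdot>\<^sub>m 1\<^sub>m n" by (rule U(3))
  finally have "\<tau> \<cdot>\<^sub>m mat_at 0 ?V = (of_nat (Suc k) * \<tau> ^ Suc k) \<cdot>\<^sub>m 1\<^sub>m n"
    by (auto intro!: eq_matI simp: algebra_simps)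
  with 1 V show ?case by blast
qed

text \<open>
  Otherwise the lowest term of \<open>T\<close> that is not scalar would survive in \<open>T\<^sup>l\<close>. If \<open>l\<close> is invertible in
  the field, it appears there multiplied by the nonzero scalar \<open>l \<tau>\<^bsup>l-1\<^esup>\<close>. If \<open>l\<close> is the
  characteristic, only its \<open>l\<close>-th power appears, which might be scalar in general; but \<open>Q\<close>
  commutes with \<open>T\<close> and thereby places the lowest term in the commutant of a cyclic matrix,
  where an element with a scalar \<open>l\<close>-th power is itself scalar.
\<close>
lemma scalar_of_prime_power_scalar:
  fixes T Q :: "'a::field poly mat"
  assumes T: "T \<in> carrier_mat n n" and Q: "Q \<in> carrier_mat n n" and comm: "Q * T = T * Q"
    and cyc: "cyclic_matrix n (mat_at 0 Q)"
    and T0: "mat_at 0 T = \<tau> \<cdot>\<^sub>m 1\<^sub>m n" "\<tau> \<noteq> 0"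
    and l: "prime l" "scalar_matrix n (T ^\<^sub>m l)"
    and n: "0 < n" "\<not> CHAR('a) dvd n"
  shows "scalar_matrix n T"
proof (rule ccontr)
  assume nonscalar: "\<not> scalar_matrix n T"
  \<comment> \<open>this choice of \<open>r\<close> makes the entry at \<open>(0, 0)\<close> of \<open>T - r\<close> vanish, so that the lowest
    coefficient of \<open>T - r\<close> cannot be a nonzero scalar matrix\<close>
  define r where "r = T $$ (0, 0)"
  define M where "M = T - r \<cdot>\<^sub>m 1\<^sub>m n"
  have M: "M \<in> carrier_mat n n" using T by (simp add: M_def minus_carrier_mat)
  have r0: "poly r 0 = \<tau>"
  proof -
    have "poly r 0 = mat_at 0 T $$ (0, 0)" using T n by (simp add: r_def)
    also have "\<dots> = \<tau>" unfolding T0 using n by simp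
    finally show ?thesis .
  qed
  have "M \<noteq> 0\<^sub>m n n"
  proof
    assume "M = 0\<^sub>m n n"
    then have "T = r \<cdot>\<^sub>m 1\<^sub>m n"
    proof -
      have "T = M + r \<cdot>\<^sub>m 1\<^sub>m n" using T by (auto intro!: eq_matI simp: M_def)
      also have "\<dots> = r \<cdot>\<^sub>m 1\<^sub>m n" using \<open>M = 0\<^sub>m n n\<close> by simp
      finally show ?thesis .
    qed
    with nonscalar show False by (auto simp: scalar_matrix_def)
  qed
  then obtain k N where N: "N \<in> carrier_mat n n" and MN: "M = [:0, 1:] ^ k \<cdot>\<^sub>m N"
    and N0: "mat_at 0 N \<noteq> 0\<^sub>m n n"
    using poly_mat_lowest_order[OF M] by metis
  have N0c: "mat_at 0 N \<in> carrier_mat n n" using N by simp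
  have xk: "[:0, 1:] ^ k \<noteq> (0 :: 'a poly)" for k by simp
  have "scalar_matrix n (mat_at 0 N)"
  \<comment> \<open>whether the linear term in \<open>s\<^sup>k N\<close> survives in \<open>T\<^sup>l = (r + s\<^sup>k N)\<^sup>l\<close> depends on \<open>l\<close> being
    invertible in the field\<close>
  proof (cases "of_nat l = (0 :: 'a)")
    case False
    obtain U where U: "U \<in> carrier_mat n n" "T ^\<^sub>m l = r ^ l \<cdot>\<^sub>m 1\<^sub>m n + M * U"
      "\<tau> \<cdot>\<^sub>m mat_at 0 U = (of_nat l * \<tau> ^ l) \<cdot>\<^sub>m 1\<^sub>m n"
      using pow_mat_around_scalar[OF T T0(1) r0, of l] unfolding M_def by blast
    have MU: "M * U \<in> carrier_mat n n" using M U by (simp add: mult_carrier_mat[of _ n n _ n])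
    have NU: "N * U \<in> carrier_mat n n" using N U by (simp add: mult_carrier_mat[of _ n n _ n])
    have "X = c \<cdot>\<^sub>m 1\<^sub>m n + X - c \<cdot>\<^sub>m 1\<^sub>m n" if "X \<in> carrier_mat n n" for X :: "'a poly mat" and c
      using that by (auto intro!: eq_matI)
    then have "M * U = T ^\<^sub>m l - r ^ l \<cdot>\<^sub>m 1\<^sub>m n"
      unfolding U(2) using MU by blast
    then have "scalar_matrix n (M * U)" using scalar_matrix_diff[OF l(2)] by simp
    then have "scalar_matrix n ([:0, 1:] ^ k \<cdot>\<^sub>m (N * U))"
      unfolding MN using N U by (simp add: mult_smult_assoc_mat[of _ n n _ n])
    then have "scalar_matrix n (N * U)" using scalar_matrix_smult_iff[OF NU xk] by simp
    then have "scalar_matrix n (mat_at 0 (N * U))" by (rule scalar_matrix_mat_at)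
    then have "scalar_matrix n (mat_at 0 N * mat_at 0 U)"
      using poly_at.mat_hom_mult[OF N U(1), of 0] by simp
    then have "scalar_matrix n (\<tau> \<cdot>\<^sub>m (mat_at 0 N * mat_at 0 U))"
      using T0(2) N U by (subst scalar_matrix_smult_iff) (auto intro: mult_carrier_mat)
    also have "\<tau> \<cdot>\<^sub>m (mat_at 0 N * mat_at 0 U) = mat_at 0 N * (\<tau> \<cdot>\<^sub>m mat_at 0 U)"
      using N U by (intro mult_smult_distrib[symmetric, of _ n n _ n]) auto
    also have "\<dots> = (of_nat l * \<tau> ^ l) \<cdot>\<^sub>m mat_at 0 N"
      unfolding U(3) using N by (simp add: scalar_mult_mat[of _ n])
    finally show ?thesis
      using False T0(2) scalar_matrix_smult_iff[OF N0c, of "of_nat l * \<tau> ^ l"] by simp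
  next
    case True
    then have "CHAR('a) dvd l" by (simp add: of_nat_eq_0_iff_char_dvd)
    then have char: "l = CHAR('a)" using l(1) CHAR_not_1'[where 'a = 'a] by (auto simp: prime_nat_iff)
    have NQ: "N * Q \<in> carrier_mat n n" "Q * N \<in> carrier_mat n n"
      using N Q by (simp_all add: mult_carrier_mat[of _ n n _ n])
    have "Q * M = M * Q"
      unfolding M_def using T Q comm by (simp add: mult_minus_distrib_mat[of _ n n _ n]
          minus_mult_distrib_mat[of _ n n _ _ n] scalar_mult_mat[of _ n])
    then have QN: "[:0, 1:] ^ k \<cdot>\<^sub>m (Q * N) = [:0, 1:] ^ k \<cdot>\<^sub>m (N * Q)"
      unfolding MN using N Q
      by (simp add: mult_smult_assoc_mat[of _ n n _ n] mult_smult_distrib[of _ n n _ n])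
    have "Q * N = N * Q"
    proof (rule eq_matI)
      fix i j assume "i < dim_row (N * Q)" "j < dim_col (N * Q)"
      then have ij: "i < n" "j < n" using N Q by auto
      have "([:0, 1:] ^ k \<cdot>\<^sub>m (Q * N)) $$ (i, j) = ([:0, 1:] ^ k \<cdot>\<^sub>m (N * Q)) $$ (i, j)"
        by (simp only: QN)
      then have "[:0, 1:] ^ k * (Q * N) $$ (i, j) = [:0, 1:] ^ k * (N * Q) $$ (i, j)"
        using N Q ij by (simp del: index_mult_mat(1))
      then show "(Q * N) $$ (i, j) = (N * Q) $$ (i, j)"
        using xk[of k] by (simp del: index_mult_mat)
    qed (use N Q in auto)
    then have comm0: "mat_at 0 Q * mat_at 0 N = mat_at 0 N * mat_at 0 Q"
      using poly_at.mat_hom_mult[OF N Q, of 0] poly_at.mat_hom_mult[OF Q N, of 0] by simp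
    have "M ^\<^sub>m l = T ^\<^sub>m l - r ^ l \<cdot>\<^sub>m 1\<^sub>m n"
      unfolding M_def using T l char by (intro freshmans_dream_mat) auto
    then have "scalar_matrix n (M ^\<^sub>m l)" using scalar_matrix_diff[OF l(2)] by simp
    then have "scalar_matrix n (([:0, 1:] ^ k) ^ l \<cdot>\<^sub>m N ^\<^sub>m l)"
      unfolding MN smult_pow_mat[OF N] .
    then have "scalar_matrix n (N ^\<^sub>m l)"
      using scalar_matrix_smult_iff[of "N ^\<^sub>m l" n "([:0, 1:] ^ k) ^ l"] N by simp
    then have "scalar_matrix n (mat_at 0 (N ^\<^sub>m l))" by (rule scalar_matrix_mat_at)
    then have "scalar_matrix n (mat_at 0 N ^\<^sub>m l)" using poly_at.mat_hom_pow[OF N] by simp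
    then show ?thesis
      using cyclic_commutant_power_scalar[OF cyc N0c comm0 l(1) char _ _ n(1)] n(2) char by simp
  qed
  then obtain c where c: "mat_at 0 N = c \<cdot>\<^sub>m 1\<^sub>m n" by (auto simp: scalar_matrix_def)
  have "[:0, 1:] ^ k * N $$ (0, 0) = M $$ (0, 0)" using N n by (simp add: MN)
  also have "\<dots> = 0" using T n by (simp add: M_def r_def)
  finally have "N $$ (0, 0) = 0" using xk[of k] by simp
  then have "mat_at 0 N $$ (0, 0) = 0" using N n by simp
  then have "c = 0" unfolding c using n by simp
  then have "mat_at 0 N = 0\<^sub>m n n" unfolding c by (auto intro!: eq_matI)
  with N0 show False by contradiction
qed

section \<open>Evaluation of noncommutative polynomials\<close>

lemma eval_mon_carrier [simp]:
  assumes "\<And>i. A i \<in> carrier_mat n n"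
  shows "eval_mon n A w \<in> carrier_mat n n"
proof -
  have "foldr (\<lambda>i M. A i * M) xs (1\<^sub>m n) \<in> carrier_mat n n" for xs
    by (induction xs) (auto intro!: mult_carrier_mat assms)
  then show ?thesis by (simp add: eval_mon_def)
qed

lemma eval_mon_Nil [simp]: "eval_mon n A (Mon []) = 1\<^sub>m n"
  by (simp add: eval_mon_def)

lemma eval_mon_Cons [simp]: "eval_mon n A (Mon (i # xs)) = A i * eval_mon n A (Mon xs)"
  by (simp add: eval_mon_def)

lemma eval_mon_append:
  assumes "\<And>i. A i \<in> carrier_mat n n"
  shows "eval_mon n A (Mon (xs @ ys)) = eval_mon n A (Mon xs) * eval_mon n A (Mon ys)"
proof (induction xs)
  case Nil
  then show ?case
    by (simp add: left_mult_one_mat[OF eval_mon_carrier[OF assms]])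
next
  case (Cons i xs)
  then show ?case
    by (simp add: assoc_mult_mat[OF assms eval_mon_carrier[OF assms] eval_mon_carrier[OF assms]])
qed

lemma eval_mat_carrier [simp]: "eval_mat n A f \<in> carrier_mat n n"
  by (simp add: eval_mat_def)

lemma eval_mat_index:
  assumes "i < n" "j < n"
  shows "eval_mat n A f $$ (i, j) =
    (\<Sum>w\<in>Poly_Mapping.keys f. Poly_Mapping.lookup f w * eval_mon n A w $$ (i, j))"
  using assms by (simp add: eval_mat_def)

lemma eval_mat_index_superset:
  assumes "i < n" "j < n" "finite S" "Poly_Mapping.keys f \<subseteq> S"
  shows "eval_mat n A f $$ (i, j) = (\<Sum>w\<in>S. Poly_Mapping.lookup f w * eval_mon n A w $$ (i, j))"
  unfolding eval_mat_index[OF assms(1,2)]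
  by (rule sum.mono_neutral_left) (use assms in \<open>auto simp: in_keys_iff\<close>)

lemma eval_mat_add: "eval_mat n A (f + g) = eval_mat n A f + eval_mat n A g"
proof (rule eq_matI)
  fix i j assume "i < dim_row (eval_mat n A f + eval_mat n A g)"
    "j < dim_col (eval_mat n A f + eval_mat n A g)"
  then have ij: "i < n" "j < n" by (simp_all add: eval_mat_def)
  let ?S = "Poly_Mapping.keys f \<union> Poly_Mapping.keys g"
  have "Poly_Mapping.keys (f + g) \<subseteq> ?S" by (rule keys_add)
  then have "eval_mat n A (f + g) $$ (i, j) =
      (\<Sum>w\<in>?S. Poly_Mapping.lookup (f + g) w * eval_mon n A w $$ (i, j))"
    using ij by (intro eval_mat_index_superset) auto
  also have "\<dots> = (\<Sum>w\<in>?S. Poly_Mapping.lookup f w * eval_mon n A w $$ (i, j))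
      + (\<Sum>w\<in>?S. Poly_Mapping.lookup g w * eval_mon n A w $$ (i, j))"
    by (simp add: lookup_add ring_distribs sum.distrib)
  also have "\<dots> = eval_mat n A f $$ (i, j) + eval_mat n A g $$ (i, j)"
    using ij by (simp add: eval_mat_index_superset[where S = ?S])
  also have "\<dots> = (eval_mat n A f + eval_mat n A g) $$ (i, j)"
    using ij by (simp add: eval_mat_def)
  finally show "eval_mat n A (f + g) $$ (i, j) = (eval_mat n A f + eval_mat n A g) $$ (i, j)" .
qed (simp_all add: eval_mat_def)

lemma eval_mat_zero: "eval_mat n A 0 = 0\<^sub>m n n"
  by (rule eq_matI) (auto simp: eval_mat_def)

lemma eval_mat_single:
  assumes "\<And>i. A i \<in> carrier_mat n n"
  shows "eval_mat n A (Poly_Mapping.single w c) = c \<cdot>\<^sub>m eval_mon n A w"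
proof (rule eq_matI)
  have d: "eval_mon n A w \<in> carrier_mat n n" using assms by simp
  fix i j assume "i < dim_row (c \<cdot>\<^sub>m eval_mon n A w)" "j < dim_col (c \<cdot>\<^sub>m eval_mon n A w)"
  then have ij: "i < n" "j < n" using d by auto
  show "eval_mat n A (Poly_Mapping.single w c) $$ (i, j) = (c \<cdot>\<^sub>m eval_mon n A w) $$ (i, j)"
    using ij d by (subst eval_mat_index_superset[where S = "{w}"]) auto
qed (use eval_mon_carrier[of A n w, OF assms] in \<open>auto simp: eval_mat_def\<close>)

text \<open>
  Induction over the monomials, which suffices for additive statements.
\<close>
lemma free_alg_induct [case_names zero add]:
  assumes "P 0" and "\<And>f w c. P f \<Longrightarrow> P (Poly_Mapping.single w c + f)"
  shows "P (f :: 'k::field free_alg)"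
proof (induction f rule: update_induct)
  case (update f a b)
  then have "Poly_Mapping.update a b f = Poly_Mapping.single a b + f"
    by (intro poly_mapping_eqI)
      (auto simp: lookup_update lookup_add lookup_single in_keys_iff when_def)
  with update assms show ?case by simp
qed (rule assms(1))

lemma eval_mat_mult:
  assumes "\<And>i. A i \<in> carrier_mat n n"
  shows "eval_mat n A (f * g) = eval_mat n A f * eval_mat n A g"
proof (induction f rule: free_alg_induct)
  case zero
  show ?case by (simp add: eval_mat_zero left_mult_zero_mat[of _ n n])
next
  case (add f w c)
  have "eval_mat n A (Poly_Mapping.single w c * g) =
      eval_mat n A (Poly_Mapping.single w c) * eval_mat n A g"
  proof (induction g rule: free_alg_induct)
    case zero
    show ?case by (simp add: eval_mat_zero right_mult_zero_mat[of _ n n])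
  next
    case (add g v d)
    have W: "eval_mon n A u \<in> carrier_mat n n" for u using assms by simp
    have "eval_mon n A (w + v) = eval_mon n A w * eval_mon n A v"
      using eval_mon_append[OF assms, where xs = "letters w" and ys = "letters v"] by (simp add: plus_free_mon_def)
    then have "eval_mat n A (Poly_Mapping.single w c * Poly_Mapping.single v d) =
        eval_mat n A (Poly_Mapping.single w c) * eval_mat n A (Poly_Mapping.single v d)"
      using W by (simp add: mult_single eval_mat_single[OF assms] mult_smult_distrib[of _ n n _ n]
            mult_smult_assoc_mat[of _ n n _ n] smult_smult_mat mult.commute[of c])
    then show ?case
      by (simp add: ring_distribs eval_mat_add add.IH mult_add_distrib_mat[of _ n n _ n])
  qed
  then show ?case
    by (simp add: ring_distribs eval_mat_add add.IH add_mult_distrib_mat[of _ n n _ _ n])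
qed

lemma eval_mat_power:
  assumes "\<And>i. A i \<in> carrier_mat n n"
  shows "eval_mat n A (f ^ k) = eval_mat n A f ^\<^sub>m k"
proof (induction k)
  case 0
  have "eval_mat n A 1 = 1 \<cdot>\<^sub>m eval_mon n A 0"
    using eval_mat_single[OF assms, where w = 0 and c = 1] by simp
  also have "\<dots> = 1\<^sub>m n"
    by (rule eq_matI) (auto simp: zero_free_mon_def)
  finally show ?case by (simp add: eval_mat_def)
next
  case (Suc k)
  then show ?case by (simp add: power_Suc2 eval_mat_mult[OF assms] del: power_Suc)
qed

lemma eval_mon_cong:
  "(\<And>l. l \<in> set xs \<Longrightarrow> A l = B l) \<Longrightarrow> eval_mon n A (Mon xs) = eval_mon n B (Mon xs)"
  by (induction xs) auto

lemma eval_mat_conj: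
  assumes A: "\<And>i. A i \<in> carrier_mat n n" and P: "P \<in> carrier_mat n n"
    and Q: "Q \<in> carrier_mat n n" and QP: "Q * P = 1\<^sub>m n" and PQ: "P * Q = 1\<^sub>m n"
  shows "eval_mat n (\<lambda>i. P * A i * Q) f = P * eval_mat n A f * Q"
proof -
  let ?B = "\<lambda>i. P * A i * Q"
  have B: "?B i \<in> carrier_mat n n" for i using A P Q by auto
  have W: "eval_mon n A w \<in> carrier_mat n n" for w using A by simp
  have E: "eval_mon n ?B (Mon xs) = P * eval_mon n A (Mon xs) * Q" for xs
  proof (induction xs)
    case Nil
    then show ?case using P PQ by simp
  next
    case (Cons i xs)
    have "P * A i * Q * (P * eval_mon n A (Mon xs) * Q) =
        P * A i * (Q * P) * eval_mon n A (Mon xs) * Q"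
      using P Q A W by (simp add: assoc_mult_mat[of _ n n _ n _ n] mult_carrier_mat[of _ n n _ n])
    also have "\<dots> = P * (A i * eval_mon n A (Mon xs)) * Q"
      unfolding QP using P Q A W by (simp add: left_mult_one_mat[of _ n n] assoc_mult_mat[of _ n n _ n _ n] mult_carrier_mat[of _ n n _ n])
    finally show ?case using Cons by simp
  qed
  then have E: "eval_mon n ?B w = P * eval_mon n A w * Q" for w
    by (cases w) auto
  show ?thesis
  proof (induction f rule: free_alg_induct)
    case zero
    show ?case using P Q by (simp add: eval_mat_zero right_mult_zero_mat[of _ n n] left_mult_zero_mat[of _ n n])
  next
    case (add f w c)
    then show ?case
      using P Q W by (simp add: eval_mat_add eval_mat_single A B E
          mult_smult_distrib[of _ n n _ n] mult_smult_assoc_mat[of _ n n _ n]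
          add_mult_distrib_mat[of _ n n _ _ n] mult_add_distrib_mat[of _ n n _ n])
  qed
qed

text \<open>
  Conjugation by the permutation matrix of \<open>\<sigma>\<close>, for \<open>\<sigma>\<close> a permutation of the indices below \<open>n\<close>.
\<close>
definition reindex :: "nat \<Rightarrow> (nat \<Rightarrow> nat) \<Rightarrow> 'a mat \<Rightarrow> 'a mat" where
  "reindex n \<sigma> M = mat n n (\<lambda>(i, j). M $$ (\<sigma> i, \<sigma> j))"

lemma reindex_carrier [simp]: "reindex n \<sigma> M \<in> carrier_mat n n"
  by (simp add: reindex_def)

text \<open>
  Reindexing by a permutation is a ring automorphism of the matrices.
\<close>
lemma eval_mat_reindex:
  assumes \<sigma>: "bij_betw \<sigma> {..<n} {..<n}" and A: "\<And>l. A l \<in> carrier_mat n n" and ij: "i < n" "j < n"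
  shows "eval_mat n (\<lambda>l. reindex n \<sigma> (A l)) f $$ (i, j) = eval_mat n A f $$ (\<sigma> i, \<sigma> j)"
proof -
  have s: "\<sigma> i < n" if "i < n" for i using \<sigma> that by (auto simp: bij_betw_def)
  have E: "eval_mon n A w \<in> carrier_mat n n" for w using A by simp
  have R: "eval_mon n (\<lambda>l. reindex n \<sigma> (A l)) w \<in> carrier_mat n n" for w by simp
  have mon: "eval_mon n (\<lambda>l. reindex n \<sigma> (A l)) (Mon xs) $$ (i, j) = eval_mon n A (Mon xs) $$ (\<sigma> i, \<sigma> j)"
    if "i < n" "j < n" for xs i j
    using that
  proof (induction xs arbitrary: i)
    case Nil
    then show ?case using s[of i] s[of j] bij_betw_imp_inj_on[OF \<sigma>] by (auto dest: inj_onD)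
  next
    case (Cons l xs)
    have "eval_mon n (\<lambda>l. reindex n \<sigma> (A l)) (Mon (l # xs)) $$ (i, j) =
        (\<Sum>k<n. A l $$ (\<sigma> i, \<sigma> k) * eval_mon n A (Mon xs) $$ (\<sigma> k, \<sigma> j))"
      using Cons R by (simp add: mat_mult_index[of _ n] del: index_mult_mat) (simp add: reindex_def)
    also have "\<dots> = (\<Sum>k<n. A l $$ (\<sigma> i, k) * eval_mon n A (Mon xs) $$ (k, \<sigma> j))"
      by (rule sum.reindex_bij_betw[OF \<sigma>])
    also have "\<dots> = eval_mon n A (Mon (l # xs)) $$ (\<sigma> i, \<sigma> j)"
      using Cons.prems A E s by (simp add: mat_mult_index[of _ n] del: index_mult_mat)
    finally show ?case .
  qed
  have "eval_mon n (\<lambda>l. reindex n \<sigma> (A l)) w $$ (i, j) = eval_mon n A w $$ (\<sigma> i, \<sigma> j)" for w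
    using mon[OF ij, of "letters w"] by simp
  then show ?thesis using ij s by (simp add: eval_mat_index)
qed

definition line :: "nat \<Rightarrow> 'a::ring_1 mat \<Rightarrow> 'a mat \<Rightarrow> 'a \<Rightarrow> 'a mat" where
  "line n A B s = mat n n (\<lambda>(i, j). A $$ (i, j) + s * (B $$ (i, j) - A $$ (i, j)))"

lemma line_carrier [simp]: "line n A B s \<in> carrier_mat n n"
  by (simp add: line_def)

lemma line_endpoints [simp]:
  assumes "A \<in> carrier_mat n n" "B \<in> carrier_mat n n"
  shows "line n A B 0 = A" "line n A B 1 = B"
  using assms by (auto intro!: eq_matI simp: line_def)

text \<open>
  Restricted to a line, the entries of the values of \<open>f\<close> are polynomials in the parameter. The
  witness is \<open>f\<close> evaluated at the generic point of the line, over \<open>K[s]\<close>.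
\<close>
lemma eval_mat_line_polynomial:
  obtains Q :: "'k::field poly mat" where "Q \<in> carrier_mat n n"
    "\<And>s. mat_at s Q = eval_mat n (\<lambda>l. line n (A l) (B l) s) f"
proof -
  define L where "L l = mat n n (\<lambda>(i, j). [:A l $$ (i, j), B l $$ (i, j) - A l $$ (i, j):])" for l
  define W where "W xs = foldr (\<lambda>l M. L l * M) xs (1\<^sub>m n)" for xs
  have L: "L l \<in> carrier_mat n n" for l by (simp add: L_def)
  have W: "W xs \<in> carrier_mat n n" for xs
    by (induction xs) (auto simp: W_def intro!: mult_carrier_mat L)
  have WE: "mat_at s (W xs) = eval_mon n (\<lambda>l. line n (A l) (B l) s) (Mon xs)" for s xs
  proof (induction xs)
    case Nil
    then show ?case by (simp add: W_def poly_at.mat_hom_one)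
  next
    case (Cons l xs)
    have "mat_at s (L l) = line n (A l) (B l) s"
      by (auto intro!: eq_matI simp: L_def line_def)
    moreover have "W (l # xs) = L l * W xs" by (simp add: W_def)
    ultimately show ?case using Cons poly_at.mat_hom_mult[OF L W, of s] by simp
  qed
  define Q where "Q = mat n n (\<lambda>(i, j). \<Sum>w\<in>Poly_Mapping.keys f.
      [:Poly_Mapping.lookup f w:] * W (letters w) $$ (i, j))"
  have "mat_at s Q = eval_mat n (\<lambda>l. line n (A l) (B l) s) f" for s
  proof (rule eq_matI)
    fix i j assume "i < dim_row (eval_mat n (\<lambda>l. line n (A l) (B l) s) f)"
      "j < dim_col (eval_mat n (\<lambda>l. line n (A l) (B l) s) f)"
    then have ij: "i < n" "j < n" by (simp_all add: eval_mat_def)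
    have "poly (W xs $$ (i, j)) s = mat_at s (W xs) $$ (i, j)" for xs
      using W[of xs] ij by simp
    then have "poly (W (letters w) $$ (i, j)) s = eval_mon n (\<lambda>l. line n (A l) (B l) s) w $$ (i, j)" for w
      by (simp add: WE)
    then show "mat_at s Q $$ (i, j) = eval_mat n (\<lambda>l. line n (A l) (B l) s) f $$ (i, j)"
      using ij by (simp add: Q_def eval_mat_index poly_sum)
  qed (simp_all add: Q_def eval_mat_def)
  then show ?thesis using that[of Q] by (simp add: Q_def)
qed

lemma prod_list_fvar:
  "(\<Prod>i\<leftarrow>xs. fvar (\<pi> i)) = Poly_Mapping.single (Mon (map \<pi> xs)) (1 :: 'k::field)"
proof (induction xs)
  case Nil
  then show ?case by (simp flip: zero_free_mon_def)
next
  case (Cons i xs)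
  then show ?case by (simp add: fvar_def mult_single plus_free_mon_def)
qed

text \<open>
  All later uses of multilinearity go through this combinatorial form.
\<close>
lemma multilinear_letters:
  assumes "multilinear m p" "w \<in> Poly_Mapping.keys p"
  shows "distinct (letters w)" "set (letters w) = {1..m}"
proof -
  obtain c where p: "p = (\<Sum>\<pi> | \<pi> permutes {1..m}. fconst (c \<pi>) * (\<Prod>i\<leftarrow>[1..<Suc m]. fvar (\<pi> i)))"
    using assms(1) unfolding multilinear_def by blast
  have "p = (\<Sum>\<pi> | \<pi> permutes {1..m}. Poly_Mapping.single (Mon (map \<pi> [1..<Suc m])) (c \<pi>))"
    unfolding p prod_list_fvar by (simp add: fconst_def mult_single del: upt_Suc)
  then have "(\<Sum>\<pi> | \<pi> permutes {1..m}.
      Poly_Mapping.lookup (Poly_Mapping.single (Mon (map \<pi> [1..<Suc m])) (c \<pi>)) w) \<noteq> 0"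
    using assms(2) by (simp add: in_keys_iff lookup_sum del: upt_Suc)
  then obtain \<pi> where \<pi>: "\<pi> permutes {1..m}"
    "Poly_Mapping.lookup (Poly_Mapping.single (Mon (map \<pi> [1..<Suc m])) (c \<pi>)) w \<noteq> 0"
    by (metis (no_types, lifting) mem_Collect_eq sum.not_neutral_contains_not_neutral)
  then have w: "letters w = map \<pi> [1..<Suc m]"
    by (auto simp: lookup_single when_def simp del: upt_Suc split: if_splits)
  have "set [1..<Suc m] = {1..m}" by auto
  then show "set (letters w) = {1..m}" unfolding w using permutes_image[OF \<pi>(1)] by (simp del: upt_Suc)
  show "distinct (letters w)" unfolding w
    using permutes_inj[OF \<pi>(1)] by (auto simp: distinct_map inj_on_def inj_def)
qed

section \<open>The grading of matrices by residues\<close>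

text \<open>
  The grading of the matrix ring by residues modulo \<open>n\<close>, in which the matrix unit at \<open>(i, j)\<close> has
  degree \<open>j - i\<close>.
\<close>
definition homogeneous :: "nat \<Rightarrow> nat \<Rightarrow> 'a::zero mat \<Rightarrow> bool" where
  "homogeneous n d M \<longleftrightarrow> M \<in> carrier_mat n n \<and>
     (\<forall>i<n. \<forall>j<n. M $$ (i, j) \<noteq> 0 \<longrightarrow> j = (i + d) mod n)"

definition component :: "nat \<Rightarrow> nat \<Rightarrow> 'a::zero mat \<Rightarrow> 'a mat" where
  "component n d M = mat n n (\<lambda>(i, j). if j = (i + d) mod n then M $$ (i, j) else 0)"

lemma component_carrier [simp]: "component n d M \<in> carrier_mat n n"
  by (simp add: component_def)

lemma homogeneous_component: "homogeneous n d (component n d M)"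
  by (auto simp: homogeneous_def component_def)

lemma homogeneous_one: "homogeneous n 0 (1\<^sub>m n)"
  by (auto simp: homogeneous_def)

lemma homogeneous_mult:
  fixes A B :: "'a::comm_ring_1 mat"
  assumes A: "homogeneous n d A" and B: "homogeneous n e B"
  shows "homogeneous n (d + e) (A * B)"
proof -
  have C: "A \<in> carrier_mat n n" "B \<in> carrier_mat n n" using A B by (auto simp: homogeneous_def)
  have "j = (i + (d + e)) mod n" if ij: "i < n" "j < n" and nz: "(A * B) $$ (i, j) \<noteq> 0" for i j
  proof -
    have "(\<Sum>l<n. A $$ (i, l) * B $$ (l, j)) \<noteq> 0"
      using nz C ij by (simp add: mat_mult_index[of _ n] del: index_mult_mat)
    then obtain l where l: "l < n" "A $$ (i, l) * B $$ (l, j) \<noteq> 0"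
      by (metis (no_types, lifting) lessThan_iff sum.not_neutral_contains_not_neutral)
    then have "A $$ (i, l) \<noteq> 0" "B $$ (l, j) \<noteq> 0" by auto
    then have "l = (i + d) mod n" "j = (l + e) mod n"
      using A B l ij by (auto simp: homogeneous_def)
    then show ?thesis by (simp add: mod_add_left_eq add.assoc)
  qed
  then show ?thesis using C by (auto simp: homogeneous_def simp del: index_mult_mat(1))
qed

lemma eval_mon_homogeneous:
  assumes "\<And>l. l \<in> set xs \<Longrightarrow> homogeneous n (d l) (A l)"
  shows "homogeneous n (\<Sum>l\<leftarrow>xs. d l) (eval_mon n A (Mon xs))"
  using assms by (induction xs) (auto simp: homogeneous_one intro: homogeneous_mult)

text \<open>
  All monomials use the same letters, each once, and therefore have the same degree.
\<close>
lemma eval_mat_homogeneous: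
  assumes p: "multilinear m p" and A: "\<And>l. l \<in> {1..m} \<Longrightarrow> homogeneous n (d l) (A l)"
  shows "homogeneous n (\<Sum>l=1..m. d l) (eval_mat n A p)"
proof -
  have "j = (i + (\<Sum>l=1..m. d l)) mod n"
    if ij: "i < n" "j < n" and nz: "eval_mat n A p $$ (i, j) \<noteq> 0" for i j
  proof -
    obtain w where w: "w \<in> Poly_Mapping.keys p" "eval_mon n A w $$ (i, j) \<noteq> 0"
      using nz unfolding eval_mat_index[OF ij]
      by (metis (no_types, lifting) mult_zero_right sum.not_neutral_contains_not_neutral)
    note letters = multilinear_letters[OF p w(1)]
    have "homogeneous n (\<Sum>l\<leftarrow>letters w. d l) (eval_mon n A (Mon (letters w)))"
      using letters A by (intro eval_mon_homogeneous) auto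
    moreover have "(\<Sum>l\<leftarrow>letters w. d l) = (\<Sum>l=1..m. d l)"
      using letters by (simp add: sum_list_distinct_conv_sum_set)
    ultimately show ?thesis using w(2) ij by (simp add: homogeneous_def)
  qed
  then show ?thesis by (simp add: homogeneous_def)
qed

lemma sum_component_index:
  fixes M :: "'a::comm_monoid_add mat"
  assumes ij: "i < n" "j < n"
  shows "(\<Sum>d<n. component n d M $$ (i, j)) = M $$ (i, j)"
proof -
  \<comment> \<open>the only degree in which \<open>(i, j)\<close> can occur: the residue of \<open>j - i\<close>\<close>
  let ?d = "(j + (n - i)) mod n"
  have "(i + ?d) mod n = (i + (j + (n - i))) mod n" by (simp add: mod_add_right_eq)
  also have "i + (j + (n - i)) = j + n" using ij by simp
  finally have hit: "(i + ?d) mod n = j" using ij by simp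
  have uniq: "d = ?d" if "d < n" "j = (i + d) mod n" for d
  proof -
    have "[i + d = i + ?d] (mod n)" using hit that unfolding cong_def by simp
    then have "[d = ?d] (mod n)" by (simp only: cong_add_lcancel_nat)
    then show ?thesis using that by (simp add: cong_def)
  qed
  have "(\<Sum>d<n. component n d M $$ (i, j)) = (\<Sum>d\<in>{?d}. component n d M $$ (i, j))"
    by (rule sum.mono_neutral_right) (use ij uniq in \<open>auto simp: component_def\<close>)
  then show ?thesis using hit ij by (simp add: component_def)
qed

text \<open>
  A monomial that contains the letter \<open>l\<close> exactly once is additive in the matrix substituted for
  it.
\<close>
lemma eval_mon_sum_component:
  assumes A: "\<And>l. A l \<in> carrier_mat n n" and xs: "distinct xs" "l \<in> set xs"
    and ij: "i < n" "j < n"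
  shows "(\<Sum>d<n. eval_mon n (A(l := component n d (A l))) (Mon xs) $$ (i, j)) =
    eval_mon n A (Mon xs) $$ (i, j)"
proof -
  obtain us vs where split: "xs = us @ l # vs" using xs(2) by (meson split_list)
  with xs(1) have notin: "l \<notin> set us" "l \<notin> set vs" by auto
  let ?E = "\<lambda>xs. eval_mon n A (Mon xs)"
  have E: "?E ys \<in> carrier_mat n n" for ys using A by simp
  have val: "eval_mon n (A(l := X)) (Mon xs) $$ (i, j) =
      (\<Sum>a<n. \<Sum>b<n. ?E us $$ (i, a) * (X $$ (a, b) * ?E vs $$ (b, j)))"
    if X: "X \<in> carrier_mat n n" for X
  proof -
    have A': "(A(l := X)) i \<in> carrier_mat n n" for i using A X by simp
    have "eval_mon n (A(l := X)) (Mon us) = ?E us" "eval_mon n (A(l := X)) (Mon vs) = ?E vs"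
      using notin by (auto intro!: eval_mon_cong)
    then have "eval_mon n (A(l := X)) (Mon xs) = ?E us * (X * ?E vs)"
      unfolding split using A' by (simp add: eval_mon_append)
    then show ?thesis
      using E X ij by (simp add: mat_mult_index[of _ n] mult_carrier_mat[of _ n n _ n] sum_distrib_left
          del: index_mult_mat)
  qed
  have "(\<Sum>d<n. eval_mon n (A(l := component n d (A l))) (Mon xs) $$ (i, j)) =
      (\<Sum>d<n. \<Sum>a<n. \<Sum>b<n. ?E us $$ (i, a) * (component n d (A l) $$ (a, b) * ?E vs $$ (b, j)))"
    by (simp only: val component_carrier)
  also have "\<dots> = (\<Sum>a<n. \<Sum>d<n. \<Sum>b<n. ?E us $$ (i, a) * (component n d (A l) $$ (a, b) * ?E vs $$ (b, j)))"
    by (rule sum.swap)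
  also have "\<dots> = (\<Sum>a<n. \<Sum>b<n. \<Sum>d<n. ?E us $$ (i, a) * (component n d (A l) $$ (a, b) * ?E vs $$ (b, j)))"
    by (intro sum.cong refl sum.swap)
  also have "\<dots> = (\<Sum>a<n. \<Sum>b<n. ?E us $$ (i, a) * (A l $$ (a, b) * ?E vs $$ (b, j)))"
    by (intro sum.cong refl) (simp add: sum_component_index flip: sum_distrib_left sum_distrib_right)
  also have "\<dots> = eval_mon n (A(l := A l)) (Mon xs) $$ (i, j)"
    by (rule val[OF A, symmetric])
  finally show ?thesis by simp
qed

lemma eval_mat_sum_component:
  assumes p: "multilinear m p" and A: "\<And>l. A l \<in> carrier_mat n n" and l: "l \<in> {1..m}"
    and ij: "i < n" "j < n"
  shows "(\<Sum>d<n. eval_mat n (A(l := component n d (A l))) p $$ (i, j)) = eval_mat n A p $$ (i, j)"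
proof -
  have "(\<Sum>d<n. eval_mon n (A(l := component n d (A l))) w $$ (i, j)) = eval_mon n A w $$ (i, j)"
    if "w \<in> Poly_Mapping.keys p" for w
    using eval_mon_sum_component[where xs = "letters w" and A = A and n = n and l = l] A l ij
      multilinear_letters[OF p that] by simp
  then show ?thesis
    unfolding eval_mat_index[OF ij] by (subst sum.swap) (simp flip: sum_distrib_left)
qed

text \<open>
  Replace the matrices by homogeneous components one letter at a time: the entry at \<open>(i, j)\<close> is
  the sum of the entries obtained from the components, so one of them is nonzero.
\<close>
lemma exists_homogeneous_substitution:
  assumes p: "multilinear m p" and A: "\<And>l. A l \<in> carrier_mat n n"
    and ij: "i < n" "j < n" and nz: "eval_mat n A p $$ (i, j) \<noteq> 0"
  shows "\<exists>B d. (\<forall>l. B l \<in> carrier_mat n n) \<and> (\<forall>l\<in>{1..m}. homogeneous n (d l) (B l)) \<and>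
    eval_mat n B p $$ (i, j) \<noteq> 0"
proof -
  have "\<exists>B d. (\<forall>l. B l \<in> carrier_mat n n) \<and> (\<forall>l\<in>{1..k}. homogeneous n (d l) (B l)) \<and>
    eval_mat n B p $$ (i, j) \<noteq> 0" if "k \<le> m" for k
    using that
  proof (induction k)
    case 0
    then show ?case using A nz by (intro exI[of _ A]) auto
  next
    case (Suc k)
    then obtain B d where B: "\<And>l. B l \<in> carrier_mat n n" "\<forall>l\<in>{1..k}. homogeneous n (d l) (B l)"
      "eval_mat n B p $$ (i, j) \<noteq> 0" by auto
    let ?l = "Suc k"
    have "(\<Sum>e<n. eval_mat n (B(?l := component n e (B ?l))) p $$ (i, j)) \<noteq> 0"
      using eval_mat_sum_component[where A = B and l = ?l, OF p B(1) _ ij] B(3) Suc.prems by simp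
    then obtain e where e: "eval_mat n (B(?l := component n e (B ?l))) p $$ (i, j) \<noteq> 0"
      by (metis (no_types, lifting) sum.not_neutral_contains_not_neutral)
    define B' where "B' = B(?l := component n e (B ?l))"
    have "B' l \<in> carrier_mat n n" for l
      using B(1) by (simp add: B'_def)
    moreover have "homogeneous n ((d(?l := e)) l) (B' l)" if "l \<in> {1..?l}" for l
      using B(2) that homogeneous_component by (auto simp: B'_def le_Suc_eq)
    ultimately show ?case using e unfolding B'_def[symmetric] by blast
  qed
  then show ?thesis by blast
qed

lemma line_homogeneous:
  assumes "homogeneous n d A" "homogeneous n d B"
  shows "homogeneous n d (line n A B s)"
  using assms unfolding homogeneous_def line_def by fastforce

section \<open>Cyclic values of a multilinear polynomial\<close>

text \<open>
  A non-scalar diagonal value becomes non-diagonal after conjugation with an elementary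
  matrix: the new entry off the diagonal is the difference of two diagonal entries.
\<close>
lemma exists_off_diagonal_value:
  fixes f :: "'k::field free_alg"
  assumes A: "\<And>l. A l \<in> carrier_mat n n" and ns: "\<not> scalar_matrix n (eval_mat n A f)"
  shows "\<exists>B i j. (\<forall>l. B l \<in> carrier_mat n n) \<and> i < n \<and> j < n \<and> i \<noteq> j \<and> eval_mat n B f $$ (i, j) \<noteq> 0"
proof (cases "\<exists>i<n. \<exists>j<n. i \<noteq> j \<and> eval_mat n A f $$ (i, j) \<noteq> 0")
  case True
  then show ?thesis using A by blast
next
  case False
  let ?D = "eval_mat n A f"
  have D: "?D \<in> carrier_mat n n" by simp
  obtain k where k: "k < n" "?D $$ (k, k) \<noteq> ?D $$ (0, 0)"
    using ns False unfolding scalar_matrix_iff[OF D] by auto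
  then have k0: "k \<noteq> 0" "0 < n" by (metis, simp)
  have zero: "?D $$ (k, 0) = 0" "?D $$ (0, k) = 0" using False k k0 by blast+
  let ?P = "addrow_mat n (-1) k 0 :: 'k mat" and ?Q = "addrow_mat n 1 k 0 :: 'k mat"
  have PQ: "?P * ?Q = 1\<^sub>m n" "?Q * ?P = 1\<^sub>m n"
    using addrow_mat_inv[of k n 0 "-1"] addrow_mat_inv[of k n 0 1] k k0 by simp_all
  have "eval_mat n (\<lambda>l. ?P * A l * ?Q) f = ?P * ?D * ?Q"
    using PQ A by (intro eval_mat_conj) auto
  also have "\<dots> = ?P * (?D * ?Q)" by (rule assoc_mult_mat[of _ n n _ n _ n]) auto
  also have "?D * ?Q = mat_addcol 1 0 k ?D"
    by (rule addcol_mat[OF D k(1), symmetric])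
  also have "?P * mat_addcol 1 0 k ?D = add_col_sub_row 1 k 0 ?D"
    unfolding add_col_sub_row_def
    by (rule addrow_mat[OF _ k0(2), of _ n, symmetric]) (simp add: mat_addcol_def eval_mat_def)
  finally have "eval_mat n (\<lambda>l. ?P * A l * ?Q) f $$ (k, 0) = ?D $$ (k, k) - ?D $$ (0, 0)"
    using zero k k0 carrier_matD[OF D] by simp
  then have "eval_mat n (\<lambda>l. ?P * A l * ?Q) f $$ (k, 0) \<noteq> 0" using k by simp
  moreover have "?P * A l * ?Q \<in> carrier_mat n n" for l
    using A by (simp add: mult_carrier_mat[of _ n n _ n])
  ultimately show ?thesis
    using k k0 by (intro exI[of _ "\<lambda>l. ?P * A l * ?Q"] exI[of _ k] exI[of _ 0]) simp
qed

lemma exists_superdiagonal_value: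
  assumes n: "2 \<le> n" and A: "\<And>l. A l \<in> carrier_mat n n" and ns: "\<not> scalar_matrix n (eval_mat n A f)"
  shows "\<exists>B. (\<forall>l. B l \<in> carrier_mat n n) \<and> eval_mat n B f $$ (0, 1) \<noteq> 0"
proof -
  obtain B i j where B: "\<And>l. B l \<in> carrier_mat n n" "i < n" "j < n" "i \<noteq> j" "eval_mat n B f $$ (i, j) \<noteq> 0"
    using exists_off_diagonal_value[where A = A, OF A ns] by blast
  \<comment> \<open>a permutation with \<open>\<sigma> 0 = i\<close> and \<open>\<sigma> 1 = j\<close>: after exchanging \<open>0\<close> and \<open>i\<close>, move the image of
    \<open>1\<close> to \<open>j\<close>, which leaves \<open>i\<close> fixed\<close>
  define \<sigma> where "\<sigma> = Transposition.transpose (Transposition.transpose 0 i 1) j \<circ> Transposition.transpose 0 i"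
  have "\<sigma> permutes {..<n}"
    unfolding \<sigma>_def using n B by (intro permutes_compose permutes_swap_id) (auto simp: Transposition.transpose_def)
  then have bij: "bij_betw \<sigma> {..<n} {..<n}" by (rule permutes_imp_bij)
  have "\<sigma> 0 = i" "\<sigma> 1 = j"
    using B(4) by (auto simp: \<sigma>_def Transposition.transpose_def)
  then have "eval_mat n (\<lambda>l. reindex n \<sigma> (B l)) f $$ (0, 1) \<noteq> 0"
    using eval_mat_reindex[where A = B, OF bij B(1), of 0 1] n B(5) by simp
  then show ?thesis by (intro exI[of _ "\<lambda>l. reindex n \<sigma> (B l)"]) simp
qed

text \<open>
  The value at suitable homogeneous matrices has degree 1 and a nonzero entry at \<open>(0, 1)\<close>.
  Shifting all indices preserves degrees and carries the nonzero entry to any prescribed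
  position \<open>(k, k + 1)\<close>. On a line joining two homogeneous substitutions of equal degrees, each
  entry that is nonzero at one of the end points is a nonzero polynomial in the parameter, so
  finitely many entries are simultaneously nonzero at some point.
\<close>
lemma exists_cyclic_value:
  fixes p :: "'k::field free_alg"
  assumes inf: "infinite (UNIV :: 'k set)" and n: "2 \<le> n" and p: "multilinear m p"
    and A: "\<And>l. A l \<in> carrier_mat n n" and ns: "\<not> scalar_matrix n (eval_mat n A p)"
  shows "\<exists>B. (\<forall>l. B l \<in> carrier_mat n n) \<and> cyclic_matrix n (eval_mat n B p)"
proof -
  obtain A' where A': "\<And>l. A' l \<in> carrier_mat n n" "eval_mat n A' p $$ (0, 1) \<noteq> 0"
    using exists_superdiagonal_value[where A = A, OF n A ns] by blast
  have n01: "0 < n" "1 < n" using n by simp_all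
  obtain B d where B: "\<And>l. B l \<in> carrier_mat n n"
    and hom: "\<And>l. l \<in> {1..m} \<Longrightarrow> homogeneous n (d l) (B l)"
    and nz: "eval_mat n B p $$ (0, 1) \<noteq> 0"
    using exists_homogeneous_substitution[where A = A', OF p A'(1) n01 A'(2)] by blast
  let ?next = "\<lambda>k. (k + 1) mod n"
  let ?ok = "\<lambda>C. (\<forall>l. C l \<in> carrier_mat n n) \<and> (\<forall>l\<in>{1..m}. homogeneous n (d l) (C l))"
  have deg: "(\<Sum>l=1..m. d l) mod n = 1"
  proof -
    have "homogeneous n (\<Sum>l=1..m. d l) (eval_mat n B p)"
      by (rule eval_mat_homogeneous[OF p hom])
    then have "1 = (0 + (\<Sum>l=1..m. d l)) mod n"
      using nz n01 unfolding homogeneous_def by blast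
    then show ?thesis by simp
  qed
  have shifted: "\<exists>C. ?ok C \<and> eval_mat n C p $$ (k, ?next k) \<noteq> 0" if k: "k < n" for k
  proof -
    \<comment> \<open>subtraction of \<open>k\<close> modulo \<open>n\<close>\<close>
    define \<sigma> where "\<sigma> i = (i + (n - k)) mod n" for i
    have inj: "i = j" if "i < n" "j < n" "\<sigma> i = \<sigma> j" for i j
    proof -
      have "[i + (n - k) = j + (n - k)] (mod n)" using that(3) by (simp add: \<sigma>_def cong_def)
      then have "[i = j] (mod n)" by (simp only: cong_add_rcancel_nat)
      with that show ?thesis by (simp add: cong_def)
    qed
    have "\<sigma> ` {..<n} \<subseteq> {..<n}" using n by (auto simp: \<sigma>_def)
    moreover have "inj_on \<sigma> {..<n}" using inj by (auto simp: inj_on_def)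
    ultimately have bij: "bij_betw \<sigma> {..<n} {..<n}"
      by (simp add: bij_betw_def endo_inj_surj)
    have hom': "homogeneous n (d l) (reindex n \<sigma> (B l))" if l: "l \<in> {1..m}" for l
      unfolding homogeneous_def
    proof (intro conjI allI impI)
      fix i j assume ij: "i < n" "j < n" "reindex n \<sigma> (B l) $$ (i, j) \<noteq> 0"
      then have "B l $$ (\<sigma> i, \<sigma> j) \<noteq> 0" by (simp add: reindex_def)
      then have "\<sigma> j = (\<sigma> i + d l) mod n"
        using hom[OF l] n unfolding homogeneous_def by (simp add: \<sigma>_def)
      also have "\<dots> = \<sigma> ((i + d l) mod n)"
        unfolding \<sigma>_def mod_add_left_eq by (simp only: ac_simps)
      finally show "j = (i + d l) mod n" using inj[of j "(i + d l) mod n"] ij n by simp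
    qed simp
    have "\<sigma> k = 0" using k by (simp add: \<sigma>_def)
    moreover have "\<sigma> (?next k) = 1"
    proof -
      have "\<sigma> (?next k) = (k + 1 + (n - k)) mod n" unfolding \<sigma>_def by (rule mod_add_left_eq)
      also have "k + 1 + (n - k) = n + 1" using k by simp
      also have "(n + 1) mod n = 1 mod n" by (rule mod_add_self1)
      finally show ?thesis using n by simp
    qed
    ultimately have "eval_mat n (\<lambda>l. reindex n \<sigma> (B l)) p $$ (k, ?next k) \<noteq> 0"
      using eval_mat_reindex[where A = B and j = "?next k", OF bij B k] n nz by simp
    then show ?thesis using hom' by (intro exI[of _ "\<lambda>l. reindex n \<sigma> (B l)"]) simp
  qed
  have "\<exists>C. ?ok C \<and> (\<forall>i<k. eval_mat n C p $$ (i, ?next i) \<noteq> 0)" if "k \<le> n" for k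
    using that
  proof (induction k)
    case 0
    then show ?case using B hom by (intro exI[of _ B]) simp
  next
    case (Suc k)
    then obtain C where C: "?ok C" "\<forall>i<k. eval_mat n C p $$ (i, ?next i) \<noteq> 0" by auto
    obtain D where D: "?ok D" "eval_mat n D p $$ (k, ?next k) \<noteq> 0"
      using shifted[of k] Suc.prems by auto
    obtain Q where Q: "Q \<in> carrier_mat n n"
      "\<And>s. mat_at s Q = eval_mat n (\<lambda>l. line n (C l) (D l) s) p"
      using eval_mat_line_polynomial[where n = n and A = C and B = D and f = p] by blast
    have val: "poly (Q $$ (i, ?next i)) s = eval_mat n (\<lambda>l. line n (C l) (D l) s) p $$ (i, ?next i)"
      if "i < Suc k" for i s
      using that Suc.prems Q(1) n by (simp flip: Q(2))
    have "Q $$ (i, ?next i) \<noteq> 0" if "i < Suc k" for i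
    proof (cases "i = k")
      case True
      have "(\<lambda>l. line n (C l) (D l) 1) = D" using C D by simp
      then show ?thesis using val[of i 1] D(2) True by auto
    next
      case False
      have "(\<lambda>l. line n (C l) (D l) 0) = C" using C D by simp
      then show ?thesis using val[of i 0] C(2) False that by auto
    qed
    then have "(\<Prod>i<Suc k. Q $$ (i, ?next i)) \<noteq> 0" by simp
    then obtain s where "poly (\<Prod>i<Suc k. Q $$ (i, ?next i)) s \<noteq> 0"
      using exists_poly_nonroot[OF inf] by blast
    then have "\<forall>i<Suc k. eval_mat n (\<lambda>l. line n (C l) (D l) s) p $$ (i, ?next i) \<noteq> 0"
      using val by (simp add: poly_prod del: prod.lessThan_Suc)
    moreover have "?ok (\<lambda>l. line n (C l) (D l) s)" using C D by (simp add: line_homogeneous)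
    ultimately show ?case by (intro exI[of _ "\<lambda>l. line n (C l) (D l) s"]) simp
  qed
  then obtain C where C: "?ok C" "\<forall>i<n. eval_mat n C p $$ (i, ?next i) \<noteq> 0" by blast
  have "homogeneous n (\<Sum>l=1..m. d l) (eval_mat n C p)"
    using C by (intro eval_mat_homogeneous[OF p]) auto
  moreover have "(i + (\<Sum>l=1..m. d l)) mod n = ?next i" for i
    by (metis deg mod_add_right_eq)
  ultimately have "cyclic_matrix n (eval_mat n C p)"
    using C(2) by (auto simp: cyclic_matrix_def homogeneous_def)
  with C show ?thesis by blast
qed

section \<open>The exponent of centrality\<close>

lemma central_on_iff:
  "central_on n f \<longleftrightarrow>
    (\<forall>A. (\<forall>l. A l \<in> carrier_mat n n) \<longrightarrow> scalar_matrix n (eval_mat n A f)) \<and>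
    (\<exists>A. (\<forall>l. A l \<in> carrier_mat n n) \<and> eval_mat n A f \<noteq> 0\<^sub>m n n)"
  by (simp add: central_on_def scalar_matrix_def)

theorem theorem4:
  fixes p :: "'k::field free_alg" and m n \<nu> :: nat
  assumes "infinite (UNIV :: 'k set)"
    and "n \<ge> 1"
    and "\<not> CHAR('k) dvd n"
    and "multilinear m p"
    and "nu_central_on \<nu> n p"
    and "\<nu> > 1"
  shows "\<nu> = n"
proof -
  have central: "central_on n (p ^ \<nu>)"
    and minimal: "\<And>k. 1 \<le> k \<Longrightarrow> k < \<nu> \<Longrightarrow> \<not> central_on n (p ^ k)"
    using assms(5) by (auto simp: nu_central_on_def)
  have scalar_nu: "scalar_matrix n (eval_mat n A (p ^ \<nu>))" if "\<And>l. A l \<in> carrier_mat n n" for A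
    using central that unfolding central_on_iff by blast
  have pow: "eval_mat n A (p ^ k) = eval_mat n A p ^\<^sub>m k" if "\<And>l. A l \<in> carrier_mat n n" for A k
    using that by (rule eval_mat_power)
  obtain A\<^sub>0 where A\<^sub>0: "\<And>l. A\<^sub>0 l \<in> carrier_mat n n" "eval_mat n A\<^sub>0 (p ^ \<nu>) \<noteq> 0\<^sub>m n n"
    using central unfolding central_on_iff by blast
  have nonzero: "eval_mat n A\<^sub>0 (p ^ k) \<noteq> 0\<^sub>m n n" if "1 \<le> k" "k \<le> \<nu>" for k
  proof
    assume "eval_mat n A\<^sub>0 (p ^ k) = 0\<^sub>m n n"
    moreover have "p ^ \<nu> = p ^ k * p ^ (\<nu> - k)" using that by (simp flip: power_add)
    ultimately have "eval_mat n A\<^sub>0 (p ^ \<nu>) = 0\<^sub>m n n"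
      using A\<^sub>0(1) by (simp add: eval_mat_mult left_mult_zero_mat[of _ n n])
    with A\<^sub>0(2) show False by contradiction
  qed
  have nonscalar: "\<exists>A. (\<forall>l. A l \<in> carrier_mat n n) \<and> \<not> scalar_matrix n (eval_mat n A (p ^ k))"
    if "1 \<le> k" "k < \<nu>" for k
    using minimal[OF that] nonzero[of k] A\<^sub>0(1) that(1) less_imp_le[OF that(2)]
    unfolding central_on_iff by blast
  obtain A\<^sub>1 where A\<^sub>1: "\<And>l. A\<^sub>1 l \<in> carrier_mat n n" "\<not> scalar_matrix n (eval_mat n A\<^sub>1 p)"
    using nonscalar[of 1] assms(6) by auto
  \<comment> \<open>every \<open>1 \<times> 1\<close> matrix is scalar\<close>
  have n: "2 \<le> n"
  proof (rule ccontr)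
    assume "\<not> 2 \<le> n"
    then have "n = 1" using assms(2) by simp
    then have "scalar_matrix n (eval_mat n A\<^sub>1 p)" by (subst scalar_matrix_iff) auto
    with A\<^sub>1 show False by blast
  qed
  obtain A where A: "\<And>l. A l \<in> carrier_mat n n" and cyc: "cyclic_matrix n (eval_mat n A p)"
    using exists_cyclic_value[where A = A\<^sub>1, OF assms(1) n assms(4) A\<^sub>1] by blast
  have "n dvd \<nu>"
    using scalar_nu[where A = A, OF A] cyclic_matrix_pow_scalar_iff[OF cyc, of \<nu>] n by (simp add: pow[where A = A, OF A])
  then obtain \<mu> where \<mu>: "\<nu> = n * \<mu>" by blast
  show ?thesis
  proof (rule ccontr)
    assume "\<nu> \<noteq> n"
    then have "\<mu> \<noteq> 1" using \<mu> by auto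
    then obtain l where l: "prime l" "l dvd \<mu>" using prime_factor_nat by blast
    then obtain \<mu>' where \<mu>': "\<mu> = \<mu>' * l" by (metis dvd_def mult.commute)
    \<comment> \<open>a proper divisor of \<open>\<nu>\<close> that is still a multiple of \<open>n\<close>, so that the cyclic value has
      a scalar \<open>k\<close>-th power\<close>
    define k where "k = n * \<mu>'"
    have \<nu>k: "\<nu> = k * l" by (simp add: k_def \<mu> \<mu>')
    have "k \<noteq> 0" using \<nu>k assms(6) by (cases k) auto
    moreover have "k < \<nu>" using \<nu>k \<open>k \<noteq> 0\<close> prime_gt_1_nat[OF l(1)] by simp
    ultimately obtain B where B: "\<And>l. B l \<in> carrier_mat n n" "\<not> scalar_matrix n (eval_mat n B (p ^ k))"
      using nonscalar[of k] by auto
    obtain Q where Q: "Q \<in> carrier_mat n n"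
      and Qs: "\<And>s. mat_at s Q = eval_mat n (\<lambda>l. line n (A l) (B l) s) p"
      using eval_mat_line_polynomial[where n = n and A = A and B = B and f = p] by blast
    have Q0: "mat_at 0 Q = eval_mat n A p" and Q1: "mat_at 1 Q = eval_mat n B p"
      using A B by (simp_all add: Qs)
    let ?T = "Q ^\<^sub>m k"
    have T: "?T \<in> carrier_mat n n" using Q by simp
    have T_l: "?T ^\<^sub>m l = Q ^\<^sub>m \<nu>" by (simp add: \<nu>k pow_mat_mult[OF Q])
    have scal: "scalar_matrix n (mat_at s (Q ^\<^sub>m \<nu>))" for s
      using scalar_nu[of "\<lambda>l. line n (A l) (B l) s"]
      by (simp add: pow Qs poly_at.mat_hom_pow[OF Q])
    have "scalar_matrix n (?T ^\<^sub>m l)"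
      unfolding T_l using Q scal by (intro scalar_matrix_if_all_mat_at[OF assms(1)]) auto
    moreover obtain \<tau> where \<tau>: "mat_at 0 ?T = \<tau> \<cdot>\<^sub>m 1\<^sub>m n"
    proof -
      have "scalar_matrix n (eval_mat n A p ^\<^sub>m k)"
        using cyclic_matrix_pow_scalar_iff[OF cyc, of k] n by (simp add: k_def)
      then show ?thesis using that by (auto simp: scalar_matrix_def poly_at.mat_hom_pow[OF Q] Q0)
    qed
    moreover have "\<tau> \<noteq> 0"
    proof
      assume "\<tau> = 0"
      have "(eval_mat n A p ^\<^sub>m k) $$ (0, 0) = mat_at 0 ?T $$ (0, 0)"
        by (simp only: poly_at.mat_hom_pow[OF Q] Q0)
      also have "\<dots> = 0" unfolding \<tau> using \<open>\<tau> = 0\<close> n by simp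
      finally show False using cyclic_matrix_pow[OF cyc, of 0 0 k] n by (simp add: k_def)
    qed
    ultimately have "scalar_matrix n ?T"
      using scalar_of_prime_power_scalar[OF T Q _ _ _ _ l(1) _ _ assms(3), of \<tau>]
        pow_mat_commute[OF Q Q refl, of k] cyc n by (simp add: Q0)
    then have "scalar_matrix n (mat_at 1 ?T)" by (rule scalar_matrix_mat_at)
    then have "scalar_matrix n (eval_mat n B (p ^ k))"
      using B by (simp add: poly_at.mat_hom_pow[OF Q] Q1 pow)
    with B(2) show False by contradiction
  qed
qed

end
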